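(* Let $m$ be an odd positive integer, let $h(z)=u(x,y)+iv(x,y)$ denote a holomorphic function in some open subset $\Xi$ of the upper half of the complex plane, and let $P_k(\underline x)$ be a homogeneous monogenic polynomial of degree $k$ in $\mathbb R^m$. Let $\mathbb R_{2k+m-2}[z]$ be the vector space of all polynomials with real coefficients in $z$ of degree at most $2k+m-2$. Then the kernel of the $\mathbb R$-linear operator $h\mapsto\mathsf{Ft}[h(z),P_k(\underline x)]$ is $$\ker\left(\mathsf{Ft}[h(z),P_k(\underline x)]\right)=\mathbb R_{2k+m-2}[z].$$
   Context: Clifford algebra: $\mathbb R_{0,m}$ is the real Clifford algebra generated by the standard basis $e_1,\dots,e_m$ of $\mathbb R^m$ with $e_ie_j+e_je_i=-2\delta_{ij}$ for $i,j=1,\dots,m$. Points of $\mathbb R^m$ are written $\underline x=\sum_{j=1}^m x_je_j$; put $r=|\underline x|$ and $\underline\omega=\underline x/r$. A homogeneous monogenic polynomial of degree $k$ in $\mathbb R^m$ is an $\mathbb R_{0,m}$-valued polynomial $P_k(\underline x)$, homogeneous of degree $k$, with $\partial_{\underline x}P_k=0$, where $\partial_{\underline x}=\sum_{j=1}^m e_j\partial_{x_j}$ is the Dirac operator in $\mathbb R^m$. Fueter mapping: for $h(z)=u(x,y)+iv(x,y)$ holomorphic in $\Xi$ ($z=x+iy$, $u,v$ real-valued), $$\mathsf{Ft}[h(z),P_k(\underline x)](x_0,\underline x)=\Delta^{k+\frac{m-1}{2}}\bigl[\bigl(u(x_0,r)+\underline\omega\,v(x_0,r)\bigr)P_k(\underline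 x)\bigr],\qquad \Delta=\sum_{j=0}^m\partial_{x_j}^2,$$ a function on $\Omega=\{(x_0,\underline x)\in\mathbb R^{m+1}: (x_0,r)\in\Xi\}$, where points $(x,y)$ of the plane are identified with $x+iy$. It is an $\mathbb R$-linear operator in $h$ between holomorphic functions and monogenic functions (functions $f$ with $(\partial_{x_0}+\partial_{\underline x})f=0$), both considered as real vector spaces.
   Formalization: P_k is assumed nonzero, and the stated equality is claimed for connected Ξ; for arbitrary open Ξ the kernel is shown to be the functions that on each connected component equal a real polynomial of degree at most 2k+m−2. *)

theory Defs
  imports "HOL-Complex_Analysis.Complex_Analysis" "HOL-Computational_Algebra.Polynomial"
begin

section \<open>The real Clifford algebra \<open>\<real>\<^bsub>0,m\<^esub>\<close>\<close>

text \<open>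
  With \<open>m = CARD('n)\<close>, an element of the algebra is given by its coordinates with respect to
  the basis blades \<open>e_A\<close>, where \<open>A\<close> ranges over the subsets of the index type and \<open>e_A\<close> is the
  product of the generators \<open>e_a\<close>, \<open>a \<in> A\<close>, in increasing order.  The linear order on the index
  type only serves to fix these products.  The type \<open>real ^ 'n set\<close> also carries a componentwise
  multiplication \<open>*\<close>, which is not the Clifford product.
\<close>

type_synonym 'n clifford = "real ^ 'n set"

definition blade :: "'n::finite set \<Rightarrow> 'n clifford"
  where "blade A = axis A 1"

text \<open>
  Sorting the word \<open>e_A e_B\<close> costs a sign for each pair \<open>b < a\<close> that has to be swapped, and
  each common index contributes \<open>e_a e_a = - 1\<close>.  Hence
  \<open>e_A e_B = clifford_sign A B *\<^sub>R e_{A \<triangle> B}\<close>.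
\<close>

definition clifford_sign :: "'n::{finite,linorder} set \<Rightarrow> 'n set \<Rightarrow> real"
  where "clifford_sign A B = (- 1) ^ card {(a, b). a \<in> A \<and> b \<in> B \<and> b \<le> a}"

definition clifford_mult ::
    "'n::{finite,linorder} clifford \<Rightarrow> 'n clifford \<Rightarrow> 'n clifford"  (infixl "\<odot>" 70)
  where "x \<odot> y =
    (\<Sum>A\<in>UNIV. \<Sum>B\<in>UNIV. (clifford_sign A B * (x $ A) * (y $ B)) *\<^sub>R blade (sym_diff A B))"

definition gen :: "'n::finite \<Rightarrow> 'n clifford"
  where "gen j = blade {j}"

definition clifford_of_real :: "real \<Rightarrow> 'n::finite clifford"
  where "clifford_of_real c = c *\<^sub>R blade {}"

definition clifford_of_vec :: "real ^ 'n::finite \<Rightarrow> 'n clifford"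
  where "clifford_of_vec x = (\<Sum>j\<in>UNIV. (x $ j) *\<^sub>R gen j)"

lemma bilinear_clifford_mult: "bilinear (\<odot>)"
  unfolding bilinear_def
  by (auto intro!: linearI
      simp: clifford_mult_def distrib_left distrib_right scaleR_add_left sum.distrib
        scaleR_sum_right mult_ac)

lemma blade_mult_blade:
  "blade A \<odot> blade B = clifford_sign A B *\<^sub>R blade (sym_diff A B)"
proof -
  have "blade A \<odot> blade B = (\<Sum>A'\<in>UNIV. \<Sum>B'\<in>UNIV. if A' = A then
      (if B' = B then clifford_sign A B *\<^sub>R blade (sym_diff A B) else 0) else 0)"
    unfolding clifford_mult_def
    by (intro sum.cong refl) (auto simp: blade_def axis_def)
  also have "\<dots> = (\<Sum>A'\<in>UNIV. if A' = A then (\<Sum>B'\<in>UNIV.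
      (if B' = B then clifford_sign A B *\<^sub>R blade (sym_diff A B) else 0)) else 0)"
    by (intro sum.cong refl) auto
  also have "\<dots> = clifford_sign A B *\<^sub>R blade (sym_diff A B)"
    by simp
  finally show ?thesis .
qed

lemma clifford_blade_expansion: "x = (\<Sum>A\<in>UNIV. (x $ A) *\<^sub>R blade A)"
  by (simp add: vec_eq_iff blade_def axis_def if_distrib cong: if_cong)

lemma clifford_sign_eq_prod:
  "clifford_sign A B = (\<Prod>a\<in>UNIV. \<Prod>b\<in>UNIV. if a \<in> A \<and> b \<in> B \<and> b \<le> a then - 1 else 1)"
proof -
  have "(\<Prod>p\<in>UNIV. if p \<in> {(a, b). a \<in> A \<and> b \<in> B \<and> b \<le> a} then - 1 else 1 :: real) =
      clifford_sign A B"
    by (subst prod.If_cases) (auto simp: clifford_sign_def)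
  then show ?thesis
    by (simp add: prod.cartesian_product split_def flip: UNIV_Times_UNIV)
qed

lemma clifford_sign_sym_diff_left:
  "clifford_sign (sym_diff A B) C = clifford_sign A C * clifford_sign B C"
  unfolding clifford_sign_eq_prod by (auto simp flip: prod.distrib intro!: prod.cong)

lemma clifford_sign_sym_diff_right:
  "clifford_sign A (sym_diff B C) = clifford_sign A B * clifford_sign A C"
  unfolding clifford_sign_eq_prod by (auto simp flip: prod.distrib intro!: prod.cong)

lemma blade_mult_assoc: "(blade A \<odot> blade B) \<odot> blade C = blade A \<odot> (blade B \<odot> blade C)"
proof -
  have "sym_diff (sym_diff A B) C = sym_diff A (sym_diff B C)" by auto
  then show ?thesis
    by (simp add: blade_mult_blade bilinear_lmul[OF bilinear_clifford_mult]
        bilinear_rmul[OF bilinear_clifford_mult] clifford_sign_sym_diff_left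
        clifford_sign_sym_diff_right)
qed

lemma linear_clifford_mult: "linear (\<lambda>x. x \<odot> y)" "linear (\<lambda>y. x \<odot> y)"
  using bilinear_clifford_mult by (auto simp: bilinear_def)

lemma linear_eq_on_blades:
  fixes f g :: "'n::finite clifford \<Rightarrow> 'b::real_vector"
  assumes "linear f" "linear g" "\<And>A. f (blade A) = g (blade A)"
  shows "f x = g x"
proof -
  have "f (\<Sum>A\<in>UNIV. (x $ A) *\<^sub>R blade A) = g (\<Sum>A\<in>UNIV. (x $ A) *\<^sub>R blade A)"
    using assms by (simp add: linear_sum linear_cmul)
  then show ?thesis
    by (simp flip: clifford_blade_expansion)
qed

lemma clifford_mult_assoc: "(x \<odot> y) \<odot> z = x \<odot> (y \<odot> z)"
proof -
  note lin = linear_clifford_mult linear_compose[OF linear_clifford_mult(1), unfolded o_def]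
    linear_compose[OF linear_clifford_mult(2), unfolded o_def]
  have 1: "(blade A \<odot> blade B) \<odot> z = blade A \<odot> (blade B \<odot> z)" for A B
    by (rule linear_eq_on_blades[of "\<lambda>z. (blade A \<odot> blade B) \<odot> z"
          "\<lambda>z. blade A \<odot> (blade B \<odot> z)"]) (intro lin blade_mult_assoc)+
  have 2: "(blade A \<odot> y) \<odot> z = blade A \<odot> (y \<odot> z)" for A
    by (rule linear_eq_on_blades[of "\<lambda>y. (blade A \<odot> y) \<odot> z"
          "\<lambda>y. blade A \<odot> (y \<odot> z)"]) (intro lin 1)+
  show ?thesis
    by (rule linear_eq_on_blades[of "\<lambda>x. (x \<odot> y) \<odot> z" "\<lambda>x. x \<odot> (y \<odot> z)"])
      (intro lin 2)+
qed

lemma clifford_mult_one_left: "blade {} \<odot> x = x"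
  by (rule linear_eq_on_blades[of "\<lambda>x. blade {} \<odot> x" "\<lambda>x. x"])
    (auto simp: linear_clifford_mult linear_ident blade_mult_blade clifford_sign_def)

lemma clifford_mult_one_right: "x \<odot> blade {} = x"
  by (rule linear_eq_on_blades[of "\<lambda>x. x \<odot> blade {}" "\<lambda>x. x"])
    (auto simp: linear_clifford_mult linear_ident blade_mult_blade clifford_sign_def)

lemma gen_anticommute:
  "gen i \<odot> gen j + gen j \<odot> gen i = clifford_of_real (if i = j then - 2 else 0)"
proof (cases "i = j")
  case True
  have "{(a, b). a = j \<and> b = j \<and> b \<le> a} = {(j, j)}" by auto
  with True show ?thesis
    by (simp add: gen_def blade_mult_blade clifford_sign_def clifford_of_real_def vec_eq_iff)
next
  case False
  have 1: "{(a, b). a = i \<and> b = j \<and> b \<le> a} = (if j \<le> i then {(i, j)} else {})" for i j :: 'a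
    by auto
  have 2: "sym_diff {i} {j} = sym_diff {j} {i}" by auto
  from False show ?thesis
    by (auto simp: gen_def blade_mult_blade clifford_sign_def clifford_of_real_def 1 2
        insert_commute simp flip: scaleR_add_left)
qed

lemma blade_insert_Min:
  assumes "\<And>a. a \<in> A \<Longrightarrow> j < a"
  shows "blade (insert j A) = gen j \<odot> blade A"
proof -
  have "{(a, b). a \<in> {j} \<and> b \<in> A \<and> b \<le> a} = {}" "sym_diff {j} A = insert j A"
    using assms by fastforce+
  then show ?thesis
    by (simp only: gen_def blade_mult_blade clifford_sign_def card.empty power_0 scaleR_one)
qed


section \<open>Differential operators\<close>

definition partial :: "'a \<Rightarrow> ('a \<Rightarrow> 'b) \<Rightarrow> 'a::real_normed_vector \<Rightarrow> 'b::real_normed_vector"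
  where "partial b f x = vector_derivative (\<lambda>t. f (x + t *\<^sub>R b)) (at 0)"

definition laplacian ::
    "('a \<Rightarrow> 'b) \<Rightarrow> 'a::euclidean_space \<Rightarrow> 'b::real_normed_vector"
  where "laplacian f x = (\<Sum>b\<in>Basis. partial b (partial b f) x)"

definition dirac ::
    "(real ^ 'n::{finite,linorder} \<Rightarrow> 'n clifford) \<Rightarrow> real ^ 'n::{finite,linorder} \<Rightarrow> 'n clifford"
  where "dirac f x = (\<Sum>j\<in>UNIV. gen j \<odot> partial (axis j 1) f x)"

definition homogeneous_monogenic_polynomial ::
    "nat \<Rightarrow> (real ^ 'n::{finite,linorder} \<Rightarrow> 'n clifford) \<Rightarrow> bool"
  where "homogeneous_monogenic_polynomial k P \<longleftrightarrow>
    polynomial_function P \<and>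
    (\<forall>t x. P (t *\<^sub>R x) = t ^ k *\<^sub>R P x) \<and>
    (\<forall>x. dirac P x = 0)"


section \<open>The Fueter mapping and its kernel\<close>

definition fueter ::
    "nat \<Rightarrow> (real ^ 'n::{finite,linorder} \<Rightarrow> 'n clifford) \<Rightarrow> (complex \<Rightarrow> complex) \<Rightarrow>
     real \<times> (real ^ 'n::{finite,linorder}) \<Rightarrow> 'n clifford"
  where "fueter k P h =
    (laplacian ^^ (k + (CARD('n) - 1) div 2))
      (\<lambda>(x0, x). let r = norm x; w = h (Complex x0 r) in
         (clifford_of_real (Re w) + Im w *\<^sub>R clifford_of_vec (x /\<^sub>R r)) \<odot> P x)"

definition axial_domain :: "complex set \<Rightarrow> (real \<times> (real ^ 'n::finite)) set"
  where "axial_domain \<Xi> = {(x0, x). Complex x0 (norm x) \<in> \<Xi>}"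

text \<open>
  Functions on \<open>\<Xi>\<close> are represented by total functions whose values outside \<open>\<Xi>\<close> are arbitrary.
  Both sets below only depend on the values on \<open>\<Xi>\<close> (for open \<open>\<Xi>\<close>), i.e. they are saturated
  with respect to equality on \<open>\<Xi>\<close>.
\<close>

definition fueter_kernel ::
    "nat \<Rightarrow> (real ^ 'n::{finite,linorder} \<Rightarrow> 'n clifford) \<Rightarrow> complex set \<Rightarrow>
     (complex \<Rightarrow> complex) set"
  where "fueter_kernel k P \<Xi> =
    {h. h holomorphic_on \<Xi> \<and> (\<forall>p\<in>axial_domain \<Xi>. fueter k P h p = 0)}"

text \<open>
  The bound is an integer because it may be \<open>- 1\<close> (namely \<open>2 k + m - 2\<close> for \<open>k = 0\<close>, \<open>m = 1\<close>),
  in which case only the zero polynomial qualifies; \<open>degree 0 = 0\<close> in the library.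
\<close>

definition real_polynomials_on :: "int \<Rightarrow> complex set \<Rightarrow> (complex \<Rightarrow> complex) set"
  where "real_polynomials_on d \<Xi> =
    {h. \<exists>q :: real poly. (q = 0 \<or> int (degree q) \<le> d) \<and>
          (\<forall>z\<in>\<Xi>. h z = poly (map_poly of_real q) z)}"

end

theory Submission
  imports Defs
begin

text \<open>
  Put \<open>n = k + (m - 1) / 2\<close> and \<open>L = (1 / r) \<partial>\<^sub>r\<close>.  Both \<open>P\<close> and \<open>x P\<close> are harmonic and homogeneous,
  of degrees \<open>k\<close> and \<open>k + 1\<close>, so each Laplacian maps \<open>L\<^sup>j u P + L\<^sup>j (v / r) x P\<close> to
  \<open>2 (n - j)\<close> times the same expression with \<open>j + 1\<close> in place of \<open>j\<close>.  As \<open>\<omega> v P = (v / r) x P\<close>, the Fueter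
  image of \<open>h\<close> is a nonzero multiple of \<open>L\<^sup>n u P + L\<^sup>n (v / r) x P\<close>, and it vanishes iff
  \<open>L\<^sup>n u = L\<^sup>n (v / r) = 0\<close>.  On a vertical segment \<open>Re z = x\<^sub>0\<close> this says that \<open>u\<close> and \<open>v / y\<close> are real
  polynomials in \<open>y\<^sup>2\<close> of degree less than \<open>n\<close>, i.e. that \<open>h\<close> agrees there with a real polynomial in
  \<open>z - x\<^sub>0\<close> of degree less than \<open>2 n\<close>.  By the identity theorem it does so on the whole component.
\<close>

section \<open>Laplacians of axially symmetric multiples of harmonic functions\<close>

lemma partial_eq_has_derivative:
  assumes "(f has_derivative D) (at x)"
  shows "partial b f x = D b"
proof -
  have g: "((\<lambda>t. x + t *\<^sub>R b) has_derivative (\<lambda>t. t *\<^sub>R b)) (at (0::real))"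
    by (auto intro!: derivative_eq_intros)
  have "((\<lambda>t. f (x + t *\<^sub>R b)) has_derivative (\<lambda>t. D (t *\<^sub>R b))) (at 0)"
    using has_derivative_compose[OF g] assms by simp
  then have "((\<lambda>t. f (x + t *\<^sub>R b)) has_vector_derivative D b) (at 0)"
    using has_derivative_bounded_linear[OF assms]
    by (simp add: has_vector_derivative_def linear_cmul bounded_linear.linear)
  then show ?thesis
    unfolding partial_def by (rule vector_derivative_at)
qed

lemma partial_cong:
  assumes "open S" "x \<in> S" "\<And>y. y \<in> S \<Longrightarrow> f y = g y"
  shows "partial b f x = partial b g x"
proof -
  have "open ((\<lambda>t. x + t *\<^sub>R b) -` S)"
    using assms(1) by (intro open_vimage continuous_intros)
  then have "\<forall>\<^sub>F t in nhds (0::real). t \<in> (\<lambda>t. x + t *\<^sub>R b) -` S"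
    using assms(2) by (intro eventually_nhds_in_open) auto
  then have "\<forall>\<^sub>F t in nhds 0. f (x + t *\<^sub>R b) = g (x + t *\<^sub>R b)"
    by eventually_elim (simp add: assms(3))
  then show ?thesis
    unfolding partial_def using assms
    by (intro vector_derivative_cong_eq) auto
qed

text \<open>The operator \<open>laplacian\<close> is total and returns default values where
  derivatives fail to exist. Here the witnesses \<open>D v x\<close> (derivative of \<open>f\<close>
  in direction \<open>v\<close>) and \<open>E v x w\<close> (derivative of \<open>D v\<close> in
  direction \<open>w\<close>) certify that they do exist, so the calculus rules for Frechet
  derivatives apply directly.\<close>

definition has_laplacian_on ::
    "('a::euclidean_space \<Rightarrow> 'b::real_normed_vector) \<Rightarrow> ('a \<Rightarrow> 'b) \<Rightarrow> 'a set \<Rightarrow> bool"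
  where "has_laplacian_on f l S \<longleftrightarrow> (\<exists>D E. \<forall>x\<in>S. (f has_derivative (\<lambda>v. D v x)) (at x) \<and>
    (\<forall>v. (D v has_derivative E v x) (at x)) \<and> l x = (\<Sum>b\<in>Basis. E b x b))"

lemma has_laplacian_on_cong:
  assumes "has_laplacian_on f l S" "\<And>x. x \<in> S \<Longrightarrow> l' x = l x"
  shows "has_laplacian_on f l' S"
proof -
  obtain D E where *: "\<forall>x\<in>S. (f has_derivative (\<lambda>v. D v x)) (at x) \<and>
    (\<forall>v. (D v has_derivative E v x) (at x)) \<and> l x = (\<Sum>b\<in>Basis. E b x b)"
    using assms(1) unfolding has_laplacian_on_def by blast
  then show ?thesis
    unfolding has_laplacian_on_def by (intro exI[of _ D] exI[of _ E]) (simp add: assms(2))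
qed

text \<open>Since \<open>S\<close> is open, the inner partial derivative equals \<open>D b\<close>
  on a whole neighbourhood of \<open>x\<close>, and so may be replaced by it before the second
  differentiation.\<close>

lemma laplacian_eq:
  assumes "has_laplacian_on f l S" "open S" "x \<in> S"
  shows "laplacian f x = l x"
proof -
  obtain D E where D: "\<And>x. x \<in> S \<Longrightarrow> (f has_derivative (\<lambda>v. D v x)) (at x)"
    and E: "\<And>x v. x \<in> S \<Longrightarrow> (D v has_derivative E v x) (at x)"
    and l: "\<And>x. x \<in> S \<Longrightarrow> l x = (\<Sum>b\<in>Basis. E b x b)"
    using assms(1) unfolding has_laplacian_on_def by blast
  have "partial b (partial b f) x = E b x b" for b
  proof -
    have "partial b (partial b f) x = partial b (D b) x"
      using assms(2,3) by (rule partial_cong) (rule partial_eq_has_derivative[OF D])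
    also have "\<dots> = E b x b"
      using E[OF assms(3)] by (rule partial_eq_has_derivative)
    finally show ?thesis .
  qed
  then show ?thesis
    using assms(3) by (simp add: laplacian_def l)
qed

lemma laplacian_cong:
  assumes "open S" "x \<in> S" "\<And>y. y \<in> S \<Longrightarrow> f y = g y"
  shows "laplacian f x = laplacian g x"
  unfolding laplacian_def
  by (intro sum.cong refl partial_cong[OF assms(1,2)] partial_cong[OF assms(1)] assms(3))

lemma has_laplacian_on_add:
  assumes "has_laplacian_on f l S" "has_laplacian_on f' l' S"
  shows "has_laplacian_on (\<lambda>x. f x + f' x) (\<lambda>x. l x + l' x) S"
proof -
  obtain D E where *: "\<forall>x\<in>S. (f has_derivative (\<lambda>v. D v x)) (at x) \<and>
    (\<forall>v. (D v has_derivative E v x) (at x)) \<and> l x = (\<Sum>b\<in>Basis. E b x b)"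
    using assms(1) unfolding has_laplacian_on_def by blast
  obtain D' E' where **: "\<forall>x\<in>S. (f' has_derivative (\<lambda>v. D' v x)) (at x) \<and>
    (\<forall>v. (D' v has_derivative E' v x) (at x)) \<and> l' x = (\<Sum>b\<in>Basis. E' b x b)"
    using assms(2) unfolding has_laplacian_on_def by blast
  show ?thesis
    unfolding has_laplacian_on_def using * **
    by (intro exI[of _ "\<lambda>v x. D v x + D' v x"] exI[of _ "\<lambda>v x w. E v x w + E' v x w"])
      (auto intro!: has_derivative_add simp: sum.distrib)
qed

lemma has_laplacian_on_scaleR:
  assumes "has_laplacian_on f l S"
  shows "has_laplacian_on (\<lambda>x. c *\<^sub>R f x) (\<lambda>x. c *\<^sub>R l x) S"
proof -
  obtain D E where *: "\<forall>x\<in>S. (f has_derivative (\<lambda>v. D v x)) (at x) \<and>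
    (\<forall>v. (D v has_derivative E v x) (at x)) \<and> l x = (\<Sum>b\<in>Basis. E b x b)"
    using assms unfolding has_laplacian_on_def by blast
  show ?thesis
    unfolding has_laplacian_on_def using *
    by (intro exI[of _ "\<lambda>v x. c *\<^sub>R D v x"] exI[of _ "\<lambda>v x w. c *\<^sub>R E v x w"])
      (auto intro!: has_derivative_scaleR_right simp: scaleR_sum_right)
qed

section \<open>Second derivatives of polynomials and of axial products\<close>

definition twice_differentiable ::
    "('a::real_normed_vector \<Rightarrow> 'b::real_normed_vector) \<Rightarrow> ('a \<Rightarrow> 'a \<Rightarrow> 'b) \<Rightarrow>
     ('a \<Rightarrow> 'a \<Rightarrow> 'a \<Rightarrow> 'b) \<Rightarrow> bool"
  where "twice_differentiable f D E \<longleftrightarrow> (\<forall>x. (f has_derivative (\<lambda>v. D v x)) (at x)) \<and>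
    (\<forall>v x. (D v has_derivative (\<lambda>w. E v w x)) (at x)) \<and> (\<forall>v w x. E v w x = E w v x)"

text \<open>Symmetry of the second derivative is carried through the induction on polynomials. It is
  used later to produce anticommutators in the square of the Dirac operator.\<close>

lemma real_polynomial_function_twice_differentiable:
  fixes p :: "'a::real_normed_vector \<Rightarrow> real"
  assumes "real_polynomial_function p"
  shows "\<exists>D E. twice_differentiable p D E"
  using assms
proof induction
  case (linear f)
  then show ?case
    by (intro exI[of _ "\<lambda>v x. f v"] exI[of _ "\<lambda>v w x. 0"])
      (auto simp: twice_differentiable_def intro: bounded_linear_imp_has_derivative)
next
  case (const c)
  show ?case
    by (intro exI[of _ "\<lambda>v x. 0"] exI[of _ "\<lambda>v w x. 0"]) (auto simp: twice_differentiable_def)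
next
  case (add f g)
  then obtain D E D' E' where "twice_differentiable f D E" "twice_differentiable g D' E'"
    by blast
  then show ?case
    by (intro exI[of _ "\<lambda>v x. D v x + D' v x"] exI[of _ "\<lambda>v w x. E v w x + E' v w x"])
      (auto simp: twice_differentiable_def intro!: has_derivative_add)
next
  case (mult f g)
  then obtain D E D' E' where "twice_differentiable f D E" "twice_differentiable g D' E'"
    by blast
  then show ?case
    by (intro exI[of _ "\<lambda>v x. f x * D' v x + D v x * g x"]
        exI[of _ "\<lambda>v w x. f x * E' v w x + D w x * D' v x + (D v x * D' w x + E v w x * g x)"])
      (auto simp: twice_differentiable_def intro!: has_derivative_add has_derivative_mult)
qed

lemma polynomial_function_twice_differentiable:
  fixes P :: "'a::real_normed_vector \<Rightarrow> 'b::euclidean_space"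
  assumes "polynomial_function P"
  shows "\<exists>D E. twice_differentiable P D E"
proof -
  have "real_polynomial_function (\<lambda>x. P x \<bullet> b)" for b
    using assms bounded_linear_inner_left[of b] by (auto simp: polynomial_function_def o_def)
  then have "\<forall>b. \<exists>D E. twice_differentiable (\<lambda>x. P x \<bullet> b) D E"
    by (intro allI real_polynomial_function_twice_differentiable)
  then obtain D E where *: "\<And>b. twice_differentiable (\<lambda>x. P x \<bullet> b) (D b) (E b)"
    by (auto dest!: choice)
  let ?D = "\<lambda>v x. \<Sum>b\<in>Basis. D b v x *\<^sub>R b" and ?E = "\<lambda>v w x. \<Sum>b\<in>Basis. E b v w x *\<^sub>R b"
  have "twice_differentiable (\<lambda>x. \<Sum>b\<in>Basis. (P x \<bullet> b) *\<^sub>R b) ?D ?E"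
    using * unfolding twice_differentiable_def
    by (auto intro!: has_derivative_sum has_derivative_scaleR_left sum.cong)
  then have "twice_differentiable P ?D ?E"
    unfolding euclidean_representation .
  then show ?thesis
    by blast
qed


text \<open>Euler's identity: differentiate \<open>Q (t *\<^sub>R x) = t ^ d *\<^sub>R Q x\<close>
  with respect to \<open>t\<close> at \<open>t = 1\<close> and compare.\<close>

lemma homogeneous_euler:
  fixes Q :: "'a::real_normed_vector \<Rightarrow> 'b::real_normed_vector"
  assumes "\<And>t x. Q (t *\<^sub>R x) = t ^ d *\<^sub>R Q x" "(Q has_derivative D) (at x)"
  shows "D x = real d *\<^sub>R Q x"
proof -
  have "((\<lambda>t. t *\<^sub>R x) has_derivative (\<lambda>t. t *\<^sub>R x)) (at (1::real))"
    by (auto intro!: derivative_eq_intros)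
  then have "((\<lambda>t. Q (t *\<^sub>R x)) has_derivative (\<lambda>t. D (t *\<^sub>R x))) (at 1)"
    by (rule has_derivative_compose) (use assms(2) in simp)
  moreover have "((\<lambda>t. t ^ d *\<^sub>R Q x) has_derivative (\<lambda>t. (t * real d) *\<^sub>R Q x)) (at (1::real))"
    by (auto intro!: derivative_eq_intros simp: mult_ac)
  ultimately have "(\<lambda>t. D (t *\<^sub>R x)) = (\<lambda>t. (t * real d) *\<^sub>R Q x)"
    unfolding assms(1) by (rule has_derivative_unique)
  from fun_cong[OF this, of 1] show ?thesis
    by simp
qed

lemma sum_Basis_prod:
  fixes f :: "'a::euclidean_space \<times> 'b::euclidean_space \<Rightarrow> 'c::comm_monoid_add"
  shows "(\<Sum>b\<in>Basis. f b) = (\<Sum>i\<in>Basis. f (i, 0)) + (\<Sum>i\<in>Basis. f (0, i))"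
proof -
  have "inj_on (\<lambda>u. (u, 0::'b)) (Basis :: 'a set)" "inj_on (\<lambda>u. (0::'a, u)) (Basis :: 'b set)"
    by (auto intro: inj_onI)
  then show ?thesis
    unfolding Basis_prod_def by (subst sum.union_disjoint) (auto simp: sum.reindex)
qed

lemma has_laplacian_on_axial:
  fixes Q :: "'a::euclidean_space \<Rightarrow> 'b::real_normed_vector"
    and a ax ar axx axr arx arr :: "real \<times> 'a \<Rightarrow> real"
  assumes Q: "twice_differentiable Q Q1 Q2" "\<And>x. (\<Sum>b\<in>Basis. Q2 b b x) = 0"
      "\<And>t x. Q (t *\<^sub>R x) = t ^ d *\<^sub>R Q x"
    and a: "\<And>q. q \<in> S \<Longrightarrow> (a has_derivative (\<lambda>v. fst v * ax q + (snd q \<bullet> snd v) * ar q)) (at q)"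
    and ax: "\<And>q. q \<in> S \<Longrightarrow> (ax has_derivative (\<lambda>v. fst v * axx q + (snd q \<bullet> snd v) * axr q)) (at q)"
    and ar: "\<And>q. q \<in> S \<Longrightarrow> (ar has_derivative (\<lambda>v. fst v * arx q + (snd q \<bullet> snd v) * arr q)) (at q)"
  shows "has_laplacian_on (\<lambda>q. a q *\<^sub>R Q (snd q))
    (\<lambda>q. (axx q + (norm (snd q))\<^sup>2 * arr q + (DIM('a) + 2 * d) * ar q) *\<^sub>R Q (snd q)) S"
proof -
  note Q1 = Q(1)[unfolded twice_differentiable_def, THEN conjunct1, rule_format]
  note Q2 = Q(1)[unfolded twice_differentiable_def, THEN conjunct2, THEN conjunct1, rule_format]
  have linD: "linear (\<lambda>v. Q1 v x)" for x
    using has_derivative_bounded_linear[OF Q1] by (rule bounded_linear.linear)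
  have linE: "linear (\<lambda>w. Q2 v w x)" for v x
    using has_derivative_bounded_linear[OF Q2] by (rule bounded_linear.linear)
  have 0: "Q1 0 x = 0" for x
    using linD by (rule linear_0)
  have euler: "(\<Sum>b\<in>Basis. (x \<bullet> b) *\<^sub>R Q1 b x) = real d *\<^sub>R Q x" for x
  proof -
    have "Q1 (\<Sum>b\<in>Basis. (x \<bullet> b) *\<^sub>R b) x = (\<Sum>b\<in>Basis. (x \<bullet> b) *\<^sub>R Q1 b x)"
      by (subst linear_sum[OF linD]) (simp add: linear_cmul[OF linD])
    then show ?thesis
      using homogeneous_euler[OF Q(3) Q1] by (simp add: euclidean_representation)
  qed
  define D where "D v q = a q *\<^sub>R Q1 (snd v) (snd q) +
    (fst v * ax q + (snd q \<bullet> snd v) * ar q) *\<^sub>R Q (snd q)" for v q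
  \<comment> \<open>The summand \<open>(snd w \<bullet> snd v) * ar q\<close> comes from
    differentiating the factor \<open>snd q \<bullet> snd v\<close>; summed over the basis it yields
    the dimension.\<close>
  define E where "E v q w = a q *\<^sub>R Q2 (snd v) (snd w) (snd q) +
    (fst w * ax q + (snd q \<bullet> snd w) * ar q) *\<^sub>R Q1 (snd v) (snd q) +
    ((fst v * ax q + (snd q \<bullet> snd v) * ar q) *\<^sub>R Q1 (snd w) (snd q) +
     (fst v * (fst w * axx q + (snd q \<bullet> snd w) * axr q) +
      ((snd q \<bullet> snd v) * (fst w * arx q + (snd q \<bullet> snd w) * arr q) + (snd w \<bullet> snd v) * ar q)) *\<^sub>R
     Q (snd q))" for v q w
  have snd: "(snd has_derivative snd) (at q)" for q :: "real \<times> 'a"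
    by (rule bounded_linear_imp_has_derivative[OF bounded_linear_snd])
  have 1: "((\<lambda>q. a q *\<^sub>R Q (snd q)) has_derivative (\<lambda>v. D v q)) (at q)" if "q \<in> S" for q
    unfolding D_def using that
    by (intro has_derivative_scaleR a has_derivative_compose[OF snd Q1])
  have 2: "(D v has_derivative E v q) (at q)" if "q \<in> S" for v q
  proof -
    have "((\<lambda>q. snd q \<bullet> snd v) has_derivative (\<lambda>w. snd w \<bullet> snd v)) (at q)"
      by (intro has_derivative_inner_left snd)
    from has_derivative_mult[OF this ar[OF that]]
    have "((\<lambda>q. fst v * ax q + (snd q \<bullet> snd v) * ar q) has_derivative
        (\<lambda>w. fst v * (fst w * axx q + (snd q \<bullet> snd w) * axr q) +
          ((snd q \<bullet> snd v) * (fst w * arx q + (snd q \<bullet> snd w) * arr q) + (snd w \<bullet> snd v) * ar q)))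
        (at q)"
      by (intro has_derivative_add has_derivative_mult_right ax[OF that])
    from has_derivative_add[OF has_derivative_scaleR[OF a[OF that]
          has_derivative_compose[OF snd Q2[of "snd v"]]]
        has_derivative_scaleR[OF this has_derivative_compose[OF snd Q1]]]
    show ?thesis
      unfolding D_def[abs_def] E_def[abs_def] .
  qed
  have 3: "(\<Sum>b\<in>Basis. E b q b) =
      (axx q + (norm (snd q))\<^sup>2 * arr q + (DIM('a) + 2 * d) * ar q) *\<^sub>R Q (snd q)" for q
  proof -
    let ?x = "snd q"
    \<comment> \<open>Every basis vector has one zero component, so the mixed terms with
      \<open>axr\<close> and \<open>arx\<close> drop out.\<close>
    have "(\<Sum>b\<in>Basis. E b q b) = E (1, 0) q (1, 0) + (\<Sum>b\<in>Basis. E (0, b) q (0, b))"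
      by (simp add: sum_Basis_prod)
    also have "E (1, 0) q (1, 0) = axx q *\<^sub>R Q ?x"
      using linear_0[OF linE] by (simp add: E_def 0)
    \<comment> \<open>For equal directions the two first-order cross terms coincide, whence the
      factor 2.\<close>
    also have "(\<Sum>b\<in>Basis. E (0, b) q (0, b)) = (\<Sum>b\<in>Basis. a q *\<^sub>R Q2 b b ?x +
        (2 * ar q) *\<^sub>R ((?x \<bullet> b) *\<^sub>R Q1 b ?x) + ((?x \<bullet> b)\<^sup>2 * arr q) *\<^sub>R Q ?x + ar q *\<^sub>R Q ?x)"
      by (intro sum.cong refl) (simp add: E_def algebra_simps power2_eq_square flip: scaleR_2)
    also have "\<dots> = a q *\<^sub>R (\<Sum>b\<in>Basis. Q2 b b ?x) +
        (2 * ar q) *\<^sub>R (\<Sum>b\<in>Basis. (?x \<bullet> b) *\<^sub>R Q1 b ?x) +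
        ((\<Sum>b\<in>Basis. (?x \<bullet> b)\<^sup>2) * arr q) *\<^sub>R Q ?x + (real DIM('a) * ar q) *\<^sub>R Q ?x"
      by (simp add: sum.distrib scaleR_sum_right scaleR_sum_left sum_distrib_right sum_constant_scaleR)
    also have "(\<Sum>b\<in>Basis. (?x \<bullet> b)\<^sup>2) = (norm ?x)\<^sup>2"
      by (subst power2_norm_eq_inner, subst euclidean_inner) (simp add: power2_eq_square)
    finally show ?thesis
      by (simp add: Q(2) euler algebra_simps)
  qed
  show ?thesis
    unfolding has_laplacian_on_def using 1 2 3
    by (intro exI[of _ D] exI[of _ E]) auto
qed


section \<open>Monogenic polynomials\<close>

lemma sum_Basis_vec:
  fixes f :: "real ^ 'n::finite \<Rightarrow> 'b::comm_monoid_add"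
  shows "(\<Sum>b\<in>Basis. f b) = (\<Sum>j\<in>UNIV. f (axis j 1))"
proof -
  have "Basis = range (\<lambda>j. axis j 1 :: real ^ 'n)"
    by (auto simp: Basis_vec_def)
  moreover have "inj (\<lambda>j. axis j 1 :: real ^ 'n)"
    by (auto intro: injI simp: axis_eq_axis)
  ultimately show ?thesis
    using sum.reindex[of "\<lambda>j. axis j 1" UNIV f] by (simp add: o_def)
qed

section \<open>Clifford multiplication by vectors\<close>

lemma linear_clifford_of_vec: "linear clifford_of_vec"
  by (auto intro!: linearI simp: clifford_of_vec_def scaleR_add_left sum.distrib scaleR_sum_right)

lemma clifford_of_vec_axis: "clifford_of_vec (axis j 1) = gen j"
proof -
  have "clifford_of_vec (axis j 1) = (\<Sum>i\<in>UNIV. if i = j then gen i else 0)"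
    unfolding clifford_of_vec_def by (intro sum.cong) (auto simp: axis_def)
  then show ?thesis
    by simp
qed

lemma clifford_of_real_mult: "clifford_of_real c \<odot> x = c *\<^sub>R x"
  by (simp add: clifford_of_real_def linear_cmul[OF linear_clifford_mult(1)] clifford_mult_one_left)

text \<open>Adding the double sum to its transpose leaves only anticommutators of generators, and
  these vanish off the diagonal.\<close>

lemma clifford_of_vec_mult_self:
  "clifford_of_vec x \<odot> clifford_of_vec x = clifford_of_real (- (norm x)\<^sup>2)"
proof -
  note lin = linear_sum[OF linear_clifford_mult(1)] linear_sum[OF linear_clifford_mult(2)]
    linear_cmul[OF linear_clifford_mult(1)] linear_cmul[OF linear_clifford_mult(2)]
  let ?v = "clifford_of_vec x"
  have *: "?v \<odot> ?v = (\<Sum>i\<in>UNIV. \<Sum>j\<in>UNIV. (x $ i * x $ j) *\<^sub>R (gen i \<odot> gen j))"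
    unfolding clifford_of_vec_def
    by (subst sum.swap) (simp add: lin scaleR_sum_right mult.commute)
  also have "\<dots> = (\<Sum>i\<in>UNIV. \<Sum>j\<in>UNIV. (x $ i * x $ j) *\<^sub>R (gen j \<odot> gen i))"
    by (subst sum.swap) (simp add: mult.commute)
  finally have "2 *\<^sub>R (?v \<odot> ?v) = (\<Sum>i\<in>UNIV. \<Sum>j\<in>UNIV. (x $ i * x $ j) *\<^sub>R
      (gen i \<odot> gen j + gen j \<odot> gen i))"
    using * by (simp add: scaleR_2 scaleR_add_right sum.distrib)
  also have "\<dots> = (\<Sum>i\<in>UNIV. \<Sum>j\<in>UNIV. if i = j then clifford_of_real (-2 * (x $ i)\<^sup>2) else 0)"
    by (intro sum.cong refl)
      (auto simp: gen_anticommute clifford_of_real_def power2_eq_square)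
  also have "\<dots> = 2 *\<^sub>R clifford_of_real (- (norm x)\<^sup>2)"
    by (simp add: clifford_of_real_def scaleR_sum_left[symmetric] sum_distrib_left[symmetric]
        sum_negf norm_vec_def L2_set_def sum_nonneg)
  finally show ?thesis
    by simp
qed

text \<open>The Clifford algebra may have zero divisors, so \<open>y\<close> cannot simply be
  cancelled. Multiplying the relation by the vector \<open>x\<close> expresses \<open>a\<close>
  times \<open>x y\<close> through \<open>y\<close>; substituting this into \<open>a\<close> times
  the relation leaves the real scalar \<open>a\<^sup>2 + (b * norm x)\<^sup>2\<close> in front of
  \<open>y\<close>.\<close>

lemma clifford_combination_eq_0_iff:
  assumes "x \<noteq> 0" "y \<noteq> 0"
  shows "a *\<^sub>R y + b *\<^sub>R (clifford_of_vec x \<odot> y) = 0 \<longleftrightarrow> a = 0 \<and> b = 0"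
proof
  let ?v = "clifford_of_vec x"
  assume *: "a *\<^sub>R y + b *\<^sub>R (?v \<odot> y) = 0"
  have vv: "?v \<odot> (?v \<odot> y) = - (norm x)\<^sup>2 *\<^sub>R y"
    by (simp add: clifford_mult_assoc[symmetric] clifford_of_vec_mult_self clifford_of_real_mult)
  have "a *\<^sub>R (?v \<odot> y) + b *\<^sub>R (?v \<odot> (?v \<odot> y)) = ?v \<odot> (a *\<^sub>R y + b *\<^sub>R (?v \<odot> y))"
    by (simp add: linear_add[OF linear_clifford_mult(2)] linear_cmul[OF linear_clifford_mult(2)])
  then have **: "a *\<^sub>R (?v \<odot> y) = (b * (norm x)\<^sup>2) *\<^sub>R y"
    unfolding * vv by (simp add: linear_0[OF linear_clifford_mult(2)])
  have "a *\<^sub>R (a *\<^sub>R y + b *\<^sub>R (?v \<odot> y)) = (a\<^sup>2) *\<^sub>R y + b *\<^sub>R (a *\<^sub>R (?v \<odot> y))"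
    by (simp add: scaleR_add_right power2_eq_square mult.commute)
  then have "(a\<^sup>2 + (b * norm x)\<^sup>2) *\<^sub>R y = 0"
    unfolding * ** by (simp add: power2_eq_square scaleR_add_left mult_ac)
  then show "a = 0 \<and> b = 0"
    using assms by (simp add: sum_power2_eq_zero_iff)
qed auto

lemma bounded_bilinear_clifford_mult:
  "bounded_bilinear ((\<odot>) :: 'n::{finite,linorder} clifford \<Rightarrow> _)"
  using bilinear_clifford_mult bilinear_conv_bounded_bilinear by blast

section \<open>Harmonicity of monogenic polynomials and of their vector multiples\<close>

lemma dirac_eq:
  assumes "twice_differentiable P D E"
  shows "dirac P x = (\<Sum>j\<in>UNIV. gen j \<odot> D (axis j 1) x)"
proof -
  have "(P has_derivative (\<lambda>v. D v x)) (at x)"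
    using assms by (simp add: twice_differentiable_def)
  from partial_eq_has_derivative[OF this] show ?thesis
    by (simp add: dirac_def)
qed

text \<open>The square of the Dirac operator is minus the Laplacian.\<close>

lemma monogenic_imp_harmonic:
  fixes P :: "real ^ 'n::{finite,linorder} \<Rightarrow> 'n clifford"
  assumes P: "twice_differentiable P D E" and "\<And>x. dirac P x = 0"
  shows "(\<Sum>b\<in>Basis. E b b x) = 0"
proof -
  let ?D = "\<lambda>j. D (axis j 1)" and ?E = "\<lambda>i j. E (axis i 1) (axis j 1) x"
  note lin = linear_sum[OF linear_clifford_mult(2)] linear_cmul[OF linear_clifford_mult(2)]
    linear_0[OF linear_clifford_mult(2)]
  have "(D v has_derivative (\<lambda>w. E v w x)) (at x)" and sym: "E v w x = E w v x" for v w
    using P unfolding twice_differentiable_def by blast+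
  then have "((\<lambda>y. \<Sum>j\<in>UNIV. gen j \<odot> ?D j y) has_derivative
      (\<lambda>w. \<Sum>j\<in>UNIV. gen j \<odot> E (axis j 1) w x)) (at x)"
    by (intro has_derivative_sum
        bounded_linear.has_derivative[OF bounded_bilinear.bounded_linear_right[OF
            bounded_bilinear_clifford_mult]])
  \<comment> \<open>The Dirac image is identically zero, so its derivative, computed termwise above,
    vanishes in every direction.\<close>
  moreover have "(\<lambda>y. \<Sum>j\<in>UNIV. gen j \<odot> ?D j y) = (\<lambda>y. 0)"
    using assms(2) by (simp add: dirac_eq[OF P])
  ultimately have 0: "(\<Sum>j\<in>UNIV. gen j \<odot> E (axis j 1) w x) = 0" for w
    using has_derivative_unique[OF _ has_derivative_const[of 0]] by (auto dest: fun_cong)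
  have "(\<Sum>i\<in>UNIV. gen i \<odot> (\<Sum>j\<in>UNIV. gen j \<odot> ?E j i)) = 0"
    by (simp add: 0 lin)
  then have 1: "(\<Sum>i\<in>UNIV. \<Sum>j\<in>UNIV. (gen i \<odot> gen j) \<odot> ?E i j) = 0"
    by (simp add: lin clifford_mult_assoc sym[of "axis i 1" "axis j 1" for i j])
  \<comment> \<open>Exchange \<open>i\<close> and \<open>j\<close> by symmetry of the second
    derivative. The sum of both versions contains only anticommutators, so only the diagonal
    survives.\<close>
  then have 2: "(\<Sum>i\<in>UNIV. \<Sum>j\<in>UNIV. (gen j \<odot> gen i) \<odot> ?E i j) = 0"
    by (subst sum.swap) (simp add: sym[of "axis i 1" "axis j 1" for i j])
  have "(\<Sum>i\<in>UNIV. \<Sum>j\<in>UNIV. (gen i \<odot> gen j + gen j \<odot> gen i) \<odot> ?E i j) = 0"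
    by (simp add: linear_add[OF linear_clifford_mult(1)] sum.distrib 1 2)
  moreover have "(gen i \<odot> gen j + gen j \<odot> gen i) \<odot> ?E i j =
      (if j = i then - 2 *\<^sub>R ?E i i else 0)" for i j
    by (simp add: gen_anticommute clifford_of_real_mult)
  ultimately have "(\<Sum>i\<in>UNIV. - 2 *\<^sub>R ?E i i) = 0"
    by simp
  then show ?thesis
    unfolding scaleR_sum_right[symmetric] by (simp add: sum_Basis_vec)
qed

lemma vec_mult_twice_differentiable:
  fixes P :: "real ^ 'n::{finite,linorder} \<Rightarrow> 'n clifford"
  assumes P: "twice_differentiable P D E"
  shows "twice_differentiable (\<lambda>x. clifford_of_vec x \<odot> P x)
    (\<lambda>v x. clifford_of_vec x \<odot> D v x + clifford_of_vec v \<odot> P x)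
    (\<lambda>v w x. clifford_of_vec x \<odot> E v w x + clifford_of_vec w \<odot> D v x + clifford_of_vec v \<odot> D w x)"
proof -
  note FD = bounded_bilinear.FDERIV[OF bounded_bilinear_clifford_mult]
    bounded_linear.has_derivative[OF bounded_bilinear.bounded_linear_right[OF
        bounded_bilinear_clifford_mult]]
  have vec: "(clifford_of_vec has_derivative clifford_of_vec) (at x)" for x :: "real ^ 'n::{finite,linorder}"
    using linear_clifford_of_vec by (intro bounded_linear_imp_has_derivative linear_conv_bounded_linear[THEN iffD1])
  show ?thesis
    using P unfolding twice_differentiable_def
    by (auto intro!: has_derivative_add FD vec)
qed

text \<open>The sum is the Laplacian of \<open>x P\<close> as given by the second derivative above:
  \<open>x\<close> times the Laplacian of \<open>P\<close>, plus twice the Dirac image of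
  \<open>P\<close>. Both vanish.\<close>

lemma monogenic_vec_mult_harmonic:
  fixes P :: "real ^ 'n::{finite,linorder} \<Rightarrow> 'n clifford"
  assumes P: "twice_differentiable P D E" and dirac: "\<And>x. dirac P x = 0"
  shows "(\<Sum>b\<in>Basis. clifford_of_vec x \<odot> E b b x + clifford_of_vec b \<odot> D b x +
    clifford_of_vec b \<odot> D b x) = 0"
proof -
  have "(\<Sum>b\<in>Basis. clifford_of_vec x \<odot> E b b x) = 0"
    using monogenic_imp_harmonic[OF assms]
    by (simp add: linear_sum[OF linear_clifford_mult(2), symmetric]
        linear_0[OF linear_clifford_mult(2)])
  moreover have "(\<Sum>b\<in>Basis. clifford_of_vec b \<odot> D b x) = 0"
    using dirac[of x] by (simp add: dirac_eq[OF P] sum_Basis_vec clifford_of_vec_axis)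
  ultimately show ?thesis
    by (simp only: sum.distrib) simp
qed


section \<open>Radial derivatives of holomorphic functions\<close>

text \<open>
  For \<open>s \<le> 1\<close> this is \<open>L\<^sup>j (h / y\<^sup>s)\<close>, where \<open>L = (1 / y) \<partial>\<^sub>y\<close>.  The recursion is the Laplace
  equation of \<open>h\<close> in disguise: \<open>\<partial>\<^sub>x\<^sup>2 g + (2 (j + s) + 1) L g + y\<^sup>2 L\<^sup>2 g = 0\<close> for \<open>g = L\<^sup>j (h / y\<^sup>s)\<close>.
\<close>

fun radial :: "nat \<Rightarrow> nat \<Rightarrow> (complex \<Rightarrow> complex) \<Rightarrow> complex \<Rightarrow> complex" where
  "radial s 0 h z = h z / of_real (Im z) ^ s"
| "radial s (Suc 0) h z =
    (\<i> * deriv h z - of_nat s * h z / of_real (Im z)) / of_real (Im z) ^ Suc s"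
| "radial s (Suc (Suc j)) h z =
    - (of_nat (2 * (j + s) + 1) * radial s (Suc j) h z + radial s j (deriv (deriv h)) z) /
      (of_real (Im z))\<^sup>2"

text \<open>Total real derivative with complex partial derivatives \<open>a\<close> in the real and
  \<open>b\<close> in the imaginary part of the argument. Division by powers of \<open>Im z\<close>
  destroys holomorphy, so a complex derivative would not do.\<close>

definition has_partials :: "(complex \<Rightarrow> complex) \<Rightarrow> complex \<Rightarrow> complex \<Rightarrow> complex \<Rightarrow> bool"
  where "has_partials f a b z \<longleftrightarrow>
    (f has_derivative (\<lambda>w. of_real (Re w) * a + of_real (Im w) * b)) (at z)"

lemma has_partials_holomorphic:
  assumes "f holomorphic_on S" "open S" "z \<in> S"
  shows "has_partials f (deriv f z) (\<i> * deriv f z) z"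
proof -
  have *: "deriv f z * w = of_real (Re w) * deriv f z + of_real (Im w) * (\<i> * deriv f z)" for w
    by (subst (1) complex_eq) (simp add: algebra_simps)
  show ?thesis
    using holomorphic_derivI[OF assms]
    unfolding has_partials_def has_field_derivative_def * .
qed

lemma has_partials_add:
  assumes "has_partials f a b z" "has_partials g a' b' z"
  shows "has_partials (\<lambda>z. f z + g z) (a + a') (b + b') z"
  using has_derivative_add[OF assms[unfolded has_partials_def]]
  by (simp add: has_partials_def algebra_simps)

lemma has_partials_cmult:
  assumes "has_partials f a b z"
  shows "has_partials (\<lambda>z. c * f z) (c * a) (c * b) z"
  using has_derivative_mult_right[OF assms[unfolded has_partials_def], of c]
  by (simp add: has_partials_def algebra_simps)

lemma has_partials_divide_Im_power:
  assumes "has_partials f a b z" "Im z \<noteq> 0"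
  shows "has_partials (\<lambda>z. f z / of_real (Im z) ^ p) (a / of_real (Im z) ^ p)
    ((b - of_nat p * f z / of_real (Im z)) / of_real (Im z) ^ p) z"
proof -
  let ?y = "complex_of_real (Im z)"
  have "((\<lambda>z. complex_of_real (Im z)) has_derivative (\<lambda>w. of_real (Im w))) (at z)"
    by (intro derivative_intros)
  from has_derivative_divide[OF assms(1)[unfolded has_partials_def] has_derivative_power[OF this, of p]]
  have "((\<lambda>z. f z / of_real (Im z) ^ p) has_derivative (\<lambda>w. - f z * (inverse (?y ^ p) *
      (of_nat p * of_real (Im w) * ?y ^ (p - 1)) * inverse (?y ^ p)) +
      (of_real (Re w) * a + of_real (Im w) * b) / ?y ^ p)) (at z)"
    using assms(2) by simp
  \<comment> \<open>The split on \<open>p\<close> isolates \<open>p = 0\<close>, where the exponent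
    \<open>p - 1\<close> truncates.\<close>
  moreover have "- f z * (inverse (?y ^ p) * (of_nat p * of_real (Im w) * ?y ^ (p - 1)) *
      inverse (?y ^ p)) + (of_real (Re w) * a + of_real (Im w) * b) / ?y ^ p =
      of_real (Re w) * (a / ?y ^ p) + of_real (Im w) * ((b - of_nat p * f z / ?y) / ?y ^ p)" for w
    using assms(2) by (cases p) (simp_all add: field_simps)
  ultimately show ?thesis
    unfolding has_partials_def by simp
qed

text \<open>This justifies reading \<open>radial\<close> as an iterate of
  \<open>(1 / y) \<partial>\<^sub>y\<close>: the vertical derivative is \<open>y\<close> times the
  next function. The horizontal derivative commutes with the construction and acts on
  \<open>h\<close> as \<open>deriv\<close>.\<close>

lemma has_partials_radial:
  assumes "open \<Xi>" "h holomorphic_on \<Xi>" "z \<in> \<Xi>" "Im z \<noteq> 0" "s \<le> 1"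
  shows "has_partials (radial s j h) (radial s j (deriv h) z) (of_real (Im z) * radial s (Suc j) h z) z"
  using assms
proof (induction s j h z rule: radial.induct)
  case (1 s h z)
  have "radial s 0 h = (\<lambda>z. h z / of_real (Im z) ^ s)"
    by (simp add: fun_eq_iff)
  with has_partials_divide_Im_power[OF has_partials_holomorphic[OF 1(2,1,3)], of s] 1(4)
  show ?case
    by simp
next
  case (2 s h z)
  let ?y = "complex_of_real (Im z)"
  have eq: "radial s (Suc 0) h =
      (\<lambda>z. (\<i> * deriv h z + (- of_nat s) * (h z / of_real (Im z) ^ 1)) / of_real (Im z) ^ Suc s)"
    by (simp add: fun_eq_iff)
  have h': "deriv h holomorphic_on \<Xi>"
    using 2 by (intro holomorphic_deriv)
  from has_partials_divide_Im_power[OF has_partials_add[OF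
      has_partials_cmult[OF has_partials_holomorphic[OF h' 2(1,3)], of \<i>]
      has_partials_cmult[OF has_partials_divide_Im_power[OF
          has_partials_holomorphic[OF 2(2,1,3)] 2(4), of 1], of "- of_nat s"]] 2(4), of "Suc s"]
  have "has_partials (radial s (Suc 0) h)
      ((\<i> * deriv (deriv h) z + (- of_nat s) * (deriv h z / ?y ^ 1)) / ?y ^ Suc s)
      ((\<i> * (\<i> * deriv (deriv h) z) +
        (- of_nat s) * ((\<i> * deriv h z - of_nat 1 * h z / ?y) / ?y ^ 1) -
        of_nat (Suc s) * (\<i> * deriv h z + (- of_nat s) * (h z / ?y ^ 1)) / ?y) / ?y ^ Suc s) z"
    unfolding eq .
  moreover have "(\<i> * deriv (deriv h) z + (- of_nat s) * (deriv h z / ?y ^ 1)) / ?y ^ Suc s =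
      radial s (Suc 0) (deriv h) z"
    by simp
  moreover have "(\<i> * (\<i> * deriv (deriv h) z) +
        (- of_nat s) * ((\<i> * deriv h z - of_nat 1 * h z / ?y) / ?y ^ 1) -
        of_nat (Suc s) * (\<i> * deriv h z + (- of_nat s) * (h z / ?y ^ 1)) / ?y) / ?y ^ Suc s =
      ?y * radial s (Suc (Suc 0)) h z"
  proof -
    \<comment> \<open>For general \<open>s\<close> the Laplace equation for \<open>h / y^s\<close>
      has an extra term proportional to \<open>s * (s - 1)\<close>; it vanishes for these two
      values.\<close>
    have "s = 0 \<or> s = 1"
      using 2(5) by auto
    then show ?thesis
      using 2(4) by (auto simp: field_simps power2_eq_square)
  qed
  ultimately show ?case
    by metis
next
  case (3 s j h z)
  let ?y = "complex_of_real (Im z)"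
  have eq: "radial s (Suc (Suc j)) h = (\<lambda>z. ((- of_nat (2 * (j + s) + 1)) * radial s (Suc j) h z +
      (- 1) * radial s j (deriv (deriv h)) z) / of_real (Im z) ^ 2)"
    by (auto simp: fun_eq_iff algebra_simps)
  have "deriv (deriv h) holomorphic_on \<Xi>"
    using 3 by (intro holomorphic_deriv)
  note IH = 3(1)[OF 3(3-7)] 3(2)[OF 3(3) this 3(5-7)]
  from has_partials_divide_Im_power[OF has_partials_add[OF
      has_partials_cmult[OF IH(1), of "- of_nat (2 * (j + s) + 1)"]
      has_partials_cmult[OF IH(2), of "- 1"]] 3(6), of 2]
  have "has_partials (radial s (Suc (Suc j)) h)
      (((- of_nat (2 * (j + s) + 1)) * radial s (Suc j) (deriv h) z +
        (- 1) * radial s j (deriv (deriv (deriv h))) z) / ?y ^ 2)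
      (((- of_nat (2 * (j + s) + 1)) * (?y * radial s (Suc (Suc j)) h z) +
        (- 1) * (?y * radial s (Suc j) (deriv (deriv h)) z) -
        of_nat 2 * ((- of_nat (2 * (j + s) + 1)) * radial s (Suc j) h z +
          (- 1) * radial s j (deriv (deriv h)) z) / ?y) / ?y ^ 2) z"
    unfolding eq .
  moreover have "((- of_nat (2 * (j + s) + 1)) * radial s (Suc j) (deriv h) z +
      (- 1) * radial s j (deriv (deriv (deriv h))) z) / ?y ^ 2 = radial s (Suc (Suc j)) (deriv h) z"
    by (simp add: algebra_simps)
  \<comment> \<open>Differentiating the divisor \<open>y^2\<close> contributes a further
    \<open>- 2\<close> times \<open>radial s (Suc (Suc j)) h z\<close>, which raises the coefficient
    \<open>2 * (j + s) + 1\<close> to its value for \<open>j + 1\<close>.\<close>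
  moreover have "((- of_nat (2 * (j + s) + 1)) * (?y * radial s (Suc (Suc j)) h z) +
        (- 1) * (?y * radial s (Suc j) (deriv (deriv h)) z) -
        of_nat 2 * ((- of_nat (2 * (j + s) + 1)) * radial s (Suc j) h z +
          (- 1) * radial s j (deriv (deriv h)) z) / ?y) / ?y ^ 2 =
      ?y * radial s (Suc (Suc (Suc j))) h z"
  proof -
    define A B where "A = radial s (Suc j) h z" and "B = radial s j (deriv (deriv h)) z"
    define C where "C = radial s (Suc j) (deriv (deriv h)) z"
    show ?thesis
      using 3(6) by (simp add: field_simps power2_eq_square flip: A_def B_def C_def)
  qed
  ultimately show ?case
    by metis
qed

section \<open>Functions annihilated by an iterated radial derivative\<close>

lemma poly_primitive:
  fixes p :: "real poly"
  obtains P where "pderiv P = p" "\<And>i. coeff P (Suc i) = coeff p i / Suc i"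
proof
  define P where "P = (\<Sum>i\<le>degree p. monom (coeff p i / Suc i) (Suc i))"
  show *: "coeff P (Suc i) = coeff p i / Suc i" for i
    by (auto simp: P_def coeff_sum coeff_eq_0)
  show "pderiv P = p"
    by (rule poly_eqI) (simp add: coeff_pderiv *)
qed

text \<open>The operator \<open>(1 / y) d/dy\<close> is twice the derivative with respect to
  \<open>y\<^sup>2\<close>, so its \<open>n\<close>-th power annihilates exactly the polynomials in
  \<open>y\<^sup>2\<close> of degree less than \<open>n\<close>. The induction shifts the sequence
  \<open>f\<close> by one. The coefficient condition also covers \<open>n = 0\<close>, where it
  forces \<open>p = 0\<close>.\<close>

lemma iterated_radial_derivative_eq_0_iff:
  fixes f :: "nat \<Rightarrow> real \<Rightarrow> real"
  assumes "open I" "convex I" "0 \<notin> I"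
    and "\<And>j y. y \<in> I \<Longrightarrow> (f j has_real_derivative y * f (Suc j) y) (at y)"
  shows "(\<forall>y\<in>I. f n y = 0) \<longleftrightarrow> (\<exists>p. (\<forall>i\<ge>n. coeff p i = 0) \<and> (\<forall>y\<in>I. f 0 y = poly p (y\<^sup>2)))"
  using assms(4)
proof (induction n arbitrary: f)
  case 0
  have "(\<forall>i. coeff p i = 0) \<longleftrightarrow> p = 0" for p :: "real poly"
    by (simp add: poly_eq_iff)
  then show ?case
    by auto
next
  case (Suc n)
  have poly_sq: "((\<lambda>y. poly p (y\<^sup>2)) has_real_derivative y * (2 * poly (pderiv p) (y\<^sup>2))) (at y)"
    for p and y :: real
    by (auto intro!: derivative_eq_intros)
  have "(\<forall>y\<in>I. f (Suc n) y = 0) \<longleftrightarrow>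
      (\<exists>p. (\<forall>i\<ge>n. coeff p i = 0) \<and> (\<forall>y\<in>I. f (Suc 0) y = poly p (y\<^sup>2)))"
    by (rule Suc.IH) (rule Suc.prems)
  also have "\<dots> \<longleftrightarrow> (\<exists>p. (\<forall>i\<ge>Suc n. coeff p i = 0) \<and> (\<forall>y\<in>I. f 0 y = poly p (y\<^sup>2)))"
  proof (intro iffI; elim exE conjE)
    fix p assume p: "\<forall>i\<ge>n. coeff p i = 0" "\<forall>y\<in>I. f (Suc 0) y = poly p (y\<^sup>2)"
    \<comment> \<open>The chain rule for \<open>poly P (y\<^sup>2)\<close> gives
      \<open>2 * y\<close>, so the primitive is taken of half of \<open>p\<close>.\<close>
    obtain P where P: "pderiv P = smult (1 / 2) p" "\<And>i. coeff P (Suc i) = coeff (smult (1 / 2) p) i / Suc i"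
      using poly_primitive by blast
    have "((\<lambda>y. f 0 y - poly P (y\<^sup>2)) has_real_derivative 0) (at y)" if "y \<in> I" for y
      using DERIV_diff[OF Suc.prems[OF that, of 0] poly_sq[of P y]] p(2) that by (simp add: P(1))
    then have "\<exists>c. \<forall>y\<in>I. f 0 y - poly P (y\<^sup>2) = c"
      by (rule has_field_derivative_zero_constant[OF assms(2) has_field_derivative_at_within])
    then obtain c where c: "\<forall>y\<in>I. f 0 y - poly P (y\<^sup>2) = c"
      by blast
    have "coeff (P + [:c:]) i = 0" if "i \<ge> Suc n" for i
      using that p(1) P(2) by (cases i) auto
    moreover have "\<forall>y\<in>I. f 0 y = poly (P + [:c:]) (y\<^sup>2)"
      using c by (auto simp: algebra_simps)
    ultimately show "\<exists>p. (\<forall>i\<ge>Suc n. coeff p i = 0) \<and> (\<forall>y\<in>I. f 0 y = poly p (y\<^sup>2))"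
      by blast
  next
    fix p assume p: "\<forall>i\<ge>Suc n. coeff p i = 0" "\<forall>y\<in>I. f 0 y = poly p (y\<^sup>2)"
    have "f (Suc 0) y = poly (smult 2 (pderiv p)) (y\<^sup>2)" if "y \<in> I" for y
    proof -
      have "(f 0 has_real_derivative y * (2 * poly (pderiv p) (y\<^sup>2))) (at y)"
        using poly_sq assms(1) that
        by (rule has_field_derivative_transform_within_open) (use p(2) in simp)
      \<comment> \<open>The two derivatives agree after multiplication by \<open>y\<close>, which is
        cancelled because \<open>0 \<notin> I\<close>.\<close>
      from DERIV_unique[OF this Suc.prems[OF that]] show ?thesis
        using that assms(3) by auto
    qed
    moreover have "\<forall>i\<ge>n. coeff (smult 2 (pderiv p)) i = 0"
      using p(1) by (simp add: coeff_pderiv)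
    ultimately show "\<exists>p. (\<forall>i\<ge>n. coeff p i = 0) \<and> (\<forall>y\<in>I. f (Suc 0) y = poly p (y\<^sup>2))"
      by blast
  qed
  finally show ?case .
qed

section \<open>Real polynomials on the imaginary axis\<close>

lemma coeff_eq_0_iff_degree_less:
  "(\<forall>i\<ge>n. coeff p i = 0) \<longleftrightarrow> p = 0 \<or> degree p < n"
  by (metis coeff_0 coeff_eq_0 leading_coeff_0_iff linorder_not_less order_less_le_trans)

text \<open>Even powers of \<open>\<i> * y\<close> are real and odd ones imaginary, so
  \<open>p\<close> and \<open>s\<close> collect the even and the odd coefficients of
  \<open>R\<close> with alternating signs.\<close>

lemma real_poly_imaginary_axis:
  fixes R :: "real poly"
  obtains p s where "\<And>i. coeff p i = (-1) ^ i * coeff R (2 * i)"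
    "\<And>i. coeff s i = (-1) ^ i * coeff R (2 * i + 1)"
    "\<And>y. poly (map_poly of_real R) (\<i> * of_real y) =
      of_real (poly p (y\<^sup>2)) + \<i> * of_real (y * poly s (y\<^sup>2))"
proof -
  have "\<exists>p s. (\<forall>i. coeff p i = (-1) ^ i * coeff R (2 * i)) \<and>
    (\<forall>i. coeff s i = (-1) ^ i * coeff R (2 * i + 1)) \<and>
    (\<forall>y. poly (map_poly of_real R) (\<i> * of_real y) =
      of_real (poly p (y\<^sup>2)) + \<i> * of_real (y * poly s (y\<^sup>2)))"
  proof (induction R)
    case 0
    show ?case
      by (auto intro!: exI[of _ 0])
  next
    case (pCons a R)
    then obtain p s where ps: "\<And>i. coeff p i = (-1) ^ i * coeff R (2 * i)"
      "\<And>i. coeff s i = (-1) ^ i * coeff R (2 * i + 1)"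
      "\<And>y. poly (map_poly of_real R) (\<i> * of_real y) =
        of_real (poly p (y\<^sup>2)) + \<i> * of_real (y * poly s (y\<^sup>2))"
      by blast
    \<comment> \<open>Multiplying \<open>p + \<i> y s\<close> by \<open>\<i> y\<close> gives
      \<open>- y\<^sup>2 s + \<i> y p\<close>: the parts swap roles, and \<open>a\<close> joins the
      even part.\<close>
    have "coeff (pCons a (- s)) i = (-1) ^ i * coeff (pCons a R) (2 * i)" for i
      by (cases i) (simp_all add: ps(2))
    moreover have "coeff p i = (-1) ^ i * coeff (pCons a R) (2 * i + 1)" for i
      by (simp add: ps(1))
    moreover have "poly (map_poly of_real (pCons a R)) (\<i> * of_real y) =
        of_real (poly (pCons a (- s)) (y\<^sup>2)) + \<i> * of_real (y * poly p (y\<^sup>2))" for y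
      using pCons(1) by (simp add: map_poly_pCons ps(3) power2_eq_square algebra_simps)
    ultimately show ?case
      by blast
  qed
  then show ?thesis
    using that by blast
qed

lemma poly_map_of_real_add:
  "poly (map_poly of_real (p + q)) z = poly (map_poly of_real p) z + poly (map_poly of_real q) z"
  for z :: "'a::real_field"
proof -
  have "map_poly of_real (p + q) = (map_poly of_real p + map_poly of_real q :: 'a poly)"
    by (rule poly_eqI) (simp add: coeff_map_poly)
  then show ?thesis
    by simp
qed

lemma poly_map_of_real_mult:
  "poly (map_poly of_real (p * q)) z = poly (map_poly of_real p) z * poly (map_poly of_real q) z"
  for z :: "'a::real_field"
  by (induction p)
    (simp_all add: poly_map_of_real_add map_poly_smult map_poly_pCons algebra_simps)

lemma poly_map_of_real_pcompose:
  "poly (map_poly of_real (pcompose p q)) z = poly (map_poly of_real p) (poly (map_poly of_real q) z)"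
  for z :: "'a::real_field"
  by (induction p)
    (simp_all add: pcompose_pCons poly_map_of_real_add poly_map_of_real_mult map_poly_pCons)

lemma poly_map_of_real_of_real:
  "poly (map_poly of_real p) (of_real x) = (of_real (poly p x) :: 'a::real_field)"
  by (induction p) (simp_all add: map_poly_pCons)

lemma even_odd_real_poly:
  fixes p s :: "real poly"
  assumes "\<forall>i\<ge>n. coeff p i = 0" "\<forall>i\<ge>n. coeff s i = 0"
  obtains R where "\<forall>i\<ge>2 * n. coeff R i = 0"
    "\<And>y. poly (map_poly of_real R) (\<i> * of_real y) =
      of_real (poly p (y\<^sup>2)) + \<i> * of_real (y * poly s (y\<^sup>2))"
proof
  \<comment> \<open>In the variable \<open>Z\<close> this is \<open>p(-Z^2) + Z s(-Z^2)\<close>, and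
    \<open>-Z^2\<close> equals \<open>y^2\<close> at \<open>Z = \<i> y\<close>. The degrees are at
    most \<open>2 * (n - 1)\<close> and \<open>2 * (n - 1) + 1\<close>, hence below
    \<open>2 * n\<close>.\<close>
  define R where "R = pcompose p [:0, 0, -1:] + pCons 0 (pcompose s [:0, 0, -1:])"
  have "coeff (pcompose p [:0, 0, -1:]) i = 0" if "i \<ge> 2 * n" for i
    using that assms(1) unfolding coeff_eq_0_iff_degree_less
    by (auto simp: degree_pcompose coeff_eq_0)
  moreover have "coeff (pCons 0 (pcompose s [:0, 0, -1:])) i = 0" if "i \<ge> 2 * n" for i
    using that assms(2) unfolding coeff_eq_0_iff_degree_less
    by (cases i) (auto simp: degree_pcompose coeff_eq_0)
  ultimately show "\<forall>i\<ge>2 * n. coeff R i = 0"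
    by (simp add: R_def)
  have "poly (map_poly of_real [:0, 0, -1:]) (\<i> * of_real y) = complex_of_real (y\<^sup>2)" for y
    by (simp add: map_poly_pCons power2_eq_square algebra_simps)
  then show "poly (map_poly of_real R) (\<i> * of_real y) =
      complex_of_real (poly p (y\<^sup>2)) + \<i> * of_real (y * poly s (y\<^sup>2))" for y
    by (simp add: R_def map_poly_pCons poly_map_of_real_add poly_map_of_real_pcompose
        poly_map_of_real_of_real del: of_real_power)
qed

section \<open>From vertical segments to connected open sets\<close>

lemma dist_Complex: "dist (Complex x y) (Complex x y') = dist y y'"
  by (simp add: dist_complex_def dist_real_def cmod_def)

lemma has_real_derivative_radial_vertical:
  assumes "open \<Xi>" "h holomorphic_on \<Xi>" "Complex x y \<in> \<Xi>" "y \<noteq> 0" "s \<le> 1" "bounded_linear L"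
  shows "((\<lambda>y. L (radial s j h (Complex x y))) has_real_derivative
    y * L (radial s (Suc j) h (Complex x y))) (at y)"
proof -
  interpret L: bounded_linear L by fact
  have "((\<lambda>y. of_real x + \<i> * of_real y) has_derivative (\<lambda>t. \<i> * of_real t)) (at y)"
    by (auto intro!: derivative_eq_intros)
  then have *: "(Complex x has_derivative (\<lambda>t. \<i> * of_real t)) (at y)"
    by (simp add: Complex_eq[abs_def])
  have "has_partials (radial s j h) (radial s j (deriv h) (Complex x y))
      (of_real y * radial s (Suc j) h (Complex x y)) (Complex x y)"
    using has_partials_radial[OF assms(1-3) _ assms(5), of j] assms(4) by simp
  from L.has_derivative[OF has_derivative_compose[OF * this[unfolded has_partials_def]]]
  have "((\<lambda>y. L (radial s j h (Complex x y))) has_derivative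
      (\<lambda>t. L ((y * t) *\<^sub>R radial s (Suc j) h (Complex x y)))) (at y)"
    by (simp add: scaleR_conv_of_real mult_ac)
  then show ?thesis
    by (simp add: has_field_derivative_def L.scaleR mult_ac mult_commute_abs)
qed

text \<open>Forward, one vertical segment determines the polynomial and analytic continuation
  spreads it over the connected set. Backward, every point gets a segment of its own, on which the
  polynomial is split into even and odd parts.\<close>

lemma radial_vanishes_iff_real_polynomial:
  assumes C: "open C" "connected C" "C \<subseteq> {z. Im z > 0}" and h: "h holomorphic_on C"
  shows "(\<forall>z\<in>C. Re (radial 0 n h z) = 0 \<and> Im (radial 1 n h z) = 0) \<longleftrightarrow>
    h \<in> real_polynomials_on (2 * int n - 1) C"
proof -
  \<comment> \<open>For \<open>n = 0\<close> the integer bound is \<open>- 1\<close>, and both sides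
    say \<open>q = 0\<close>.\<close>
  have bound: "(q = 0 \<or> int (degree q) \<le> 2 * int n - 1) \<longleftrightarrow> (\<forall>i\<ge>2 * n. coeff q i = 0)"
    for q :: "real poly"
    unfolding coeff_eq_0_iff_degree_less by auto
  have segment: "\<exists>I. open I \<and> convex I \<and> 0 \<notin> I \<and> y \<in> I \<and> Complex x ` I \<subseteq> C"
    if z: "Complex x y \<in> C" for x y
  proof -
    obtain e where e: "e > 0" "ball (Complex x y) e \<subseteq> C"
      using openE[OF C(1) z] by blast
    have I: "Complex x y' \<in> C" if "y' \<in> ball y e" for y'
      using that e(2) by (auto simp: dist_Complex)
    \<comment> \<open>Otherwise a real point would lie in \<open>C\<close>, which is contained in
      the open upper half plane.\<close>
    moreover have "0 \<notin> ball y e"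
      using I[of 0] C(3) by auto
    ultimately show ?thesis
      using e(1) by (intro exI[of _ "ball y e"]) auto
  qed
  have even: "(\<forall>y\<in>I. Re (radial 0 n h (Complex x y)) = 0) \<longleftrightarrow>
      (\<exists>p. (\<forall>i\<ge>n. coeff p i = 0) \<and> (\<forall>y\<in>I. Re (h (Complex x y)) = poly p (y\<^sup>2)))"
    and odd: "(\<forall>y\<in>I. Im (radial 1 n h (Complex x y)) = 0) \<longleftrightarrow>
      (\<exists>s. (\<forall>i\<ge>n. coeff s i = 0) \<and> (\<forall>y\<in>I. Im (h (Complex x y)) = y * poly s (y\<^sup>2)))"
    if I: "open I" "convex I" "0 \<notin> I" "Complex x ` I \<subseteq> C" for I x
  proof -
    have deriv: "((\<lambda>y. L (radial s j h (Complex x y))) has_real_derivative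
        y * L (radial s (Suc j) h (Complex x y))) (at y)"
      if "s \<le> 1" "bounded_linear L" "y \<in> I" for s j L y
      using that I by (intro has_real_derivative_radial_vertical[OF C(1) h]) auto
    show "(\<forall>y\<in>I. Re (radial 0 n h (Complex x y)) = 0) \<longleftrightarrow>
        (\<exists>p. (\<forall>i\<ge>n. coeff p i = 0) \<and> (\<forall>y\<in>I. Re (h (Complex x y)) = poly p (y\<^sup>2)))"
      using iterated_radial_derivative_eq_0_iff[OF I(1-3), of "\<lambda>j y. Re (radial 0 j h (Complex x y))" n]
      by (simp add: deriv bounded_linear_Re)
    have "(\<forall>y\<in>I. Im (radial 1 n h (Complex x y)) = 0) \<longleftrightarrow>
        (\<exists>s. (\<forall>i\<ge>n. coeff s i = 0) \<and> (\<forall>y\<in>I. Im (h (Complex x y)) / y = poly s (y\<^sup>2)))"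
      using iterated_radial_derivative_eq_0_iff[OF I(1-3), of "\<lambda>j y. Im (radial 1 j h (Complex x y))" n]
      by (simp add: deriv bounded_linear_Im)
    moreover have "Im (h (Complex x y)) / y = c \<longleftrightarrow> Im (h (Complex x y)) = y * c" if "y \<in> I" for y c
      using that I(3) by (auto simp: field_simps)
    ultimately show "(\<forall>y\<in>I. Im (radial 1 n h (Complex x y)) = 0) \<longleftrightarrow>
        (\<exists>s. (\<forall>i\<ge>n. coeff s i = 0) \<and> (\<forall>y\<in>I. Im (h (Complex x y)) = y * poly s (y\<^sup>2)))"
      by simp
  qed
  show ?thesis
  proof
    assume vanish: "\<forall>z\<in>C. Re (radial 0 n h z) = 0 \<and> Im (radial 1 n h z) = 0"
    show "h \<in> real_polynomials_on (2 * int n - 1) C"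
    proof (cases "C = {}")
      case True
      then show ?thesis
        by (auto simp: real_polynomials_on_def)
    next
      case False
      then obtain x y where z: "Complex x y \<in> C"
        by (metis complex.collapse ex_in_conv)
      from segment[OF z] obtain I where I: "open I" "convex I" "0 \<notin> I" "Complex x ` I \<subseteq> C" and y: "y \<in> I"
        by blast
      obtain p where p: "\<forall>i\<ge>n. coeff p i = 0" "\<forall>y\<in>I. Re (h (Complex x y)) = poly p (y\<^sup>2)"
        using even[OF I] vanish I(4) by blast
      obtain s where s: "\<forall>i\<ge>n. coeff s i = 0" "\<forall>y\<in>I. Im (h (Complex x y)) = y * poly s (y\<^sup>2)"
        using odd[OF I] vanish I(4) by blast
      obtain R where R: "\<forall>i\<ge>2 * n. coeff R i = 0"
        "\<And>y. poly (map_poly of_real R) (\<i> * of_real y) =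
          of_real (poly p (y\<^sup>2)) + \<i> * of_real (y * poly s (y\<^sup>2))"
        using even_odd_real_poly[OF p(1) s(1)] by blast
      \<comment> \<open>Shifting from powers of \<open>z - x\<close> to powers of \<open>z\<close>
        preserves the degree, and the coefficients stay real because \<open>x\<close> is
        real.\<close>
      define q where "q = pcompose R [:-x, 1:]"
      have "poly (map_poly of_real q) (Complex x y) = h (Complex x y)" if "y \<in> I" for y
      proof -
        have "poly (map_poly of_real q) (Complex x y) = poly (map_poly of_real R) (\<i> * of_real y)"
          by (simp add: q_def poly_map_of_real_pcompose map_poly_pCons Complex_eq)
        also have "\<dots> = h (Complex x y)"
          using p(2) s(2) that by (subst R(2)) (simp add: complex_eq_iff)
        finally show ?thesis .
      qed
      \<comment> \<open>The identity theorem needs the agreement set to accumulate at a point of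
        \<open>C\<close>; a vertical segment does so.\<close>
      moreover have "Complex x y islimpt Complex x ` I"
      proof -
        have "y islimpt I"
          using I(1) y by (simp add: interior_limit_point interior_open)
        then show ?thesis
          by (simp add: islimpt_approachable dist_Complex)
      qed
      moreover have "(\<lambda>w. h w - poly (map_poly of_real q) w) holomorphic_on C"
        using h by (intro holomorphic_intros)
      ultimately have "h w - poly (map_poly of_real q) w = 0" if "w \<in> C" for w
        using analytic_continuation[OF _ C(1,2) I(4) z] that by force
      moreover have "\<forall>i\<ge>2 * n. coeff q i = 0"
        using R(1) unfolding q_def coeff_eq_0_iff_degree_less by (auto simp: degree_pcompose)
      ultimately show ?thesis
        unfolding real_polynomials_on_def bound by (auto intro!: exI[of _ q])
    qed
  next
    assume "h \<in> real_polynomials_on (2 * int n - 1) C"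
    then obtain q where q: "\<forall>i\<ge>2 * n. coeff q i = 0" "\<And>z. z \<in> C \<Longrightarrow> h z = poly (map_poly of_real q) z"
      unfolding real_polynomials_on_def bound by blast
    have "Re (radial 0 n h (Complex x y)) = 0 \<and> Im (radial 1 n h (Complex x y)) = 0"
      if z: "Complex x y \<in> C" for x y
    proof -
      from segment[OF z] obtain I where I: "open I" "convex I" "0 \<notin> I" "Complex x ` I \<subseteq> C" and y: "y \<in> I"
        by blast
      \<comment> \<open>Recentring at the real part \<open>x\<close> turns values of
        \<open>q\<close> on the vertical line into values of \<open>R\<close> on the imaginary
        axis.\<close>
      define R where "R = pcompose q [:x, 1:]"
      have R: "\<forall>i\<ge>2 * n. coeff R i = 0"
        using q(1) unfolding R_def coeff_eq_0_iff_degree_less by (auto simp: degree_pcompose)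
      obtain p s where ps: "\<And>i. coeff p i = (-1) ^ i * coeff R (2 * i)"
        "\<And>i. coeff s i = (-1) ^ i * coeff R (2 * i + 1)"
        "\<And>y. poly (map_poly of_real R) (\<i> * of_real y) =
          of_real (poly p (y\<^sup>2)) + \<i> * of_real (y * poly s (y\<^sup>2))"
        using real_poly_imaginary_axis by blast
      have "h (Complex x y) = of_real (poly p (y\<^sup>2)) + \<i> * of_real (y * poly s (y\<^sup>2))"
        if "y \<in> I" for y
      proof -
        have "h (Complex x y) = poly (map_poly of_real R) (\<i> * of_real y)"
          using q(2) that I(4)
          by (auto simp: R_def poly_map_of_real_pcompose map_poly_pCons Complex_eq)
        then show ?thesis
          by (simp only: ps(3))
      qed
      moreover have "\<forall>i\<ge>n. coeff p i = 0" "\<forall>i\<ge>n. coeff s i = 0"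
        using R by (auto simp: ps)
      ultimately have "\<forall>y\<in>I. Re (radial 0 n h (Complex x y)) = 0"
        "\<forall>y\<in>I. Im (radial 1 n h (Complex x y)) = 0"
        unfolding even[OF I] odd[OF I] by (intro exI[of _ p] exI[of _ s]; simp)+
      then show ?thesis
        using y by blast
    qed
    then show "\<forall>z\<in>C. Re (radial 0 n h z) = 0 \<and> Im (radial 1 n h z) = 0"
      by (metis complex.collapse)
  qed
qed


section \<open>The kernel of the Fueter mapping\<close>

lemma open_axial_domain:
  assumes "open \<Xi>"
  shows "open (axial_domain \<Xi> :: (real \<times> (real ^ 'n::finite)) set)"
proof -
  have "open ((\<lambda>q. Complex (fst q) (norm (snd q))) -` \<Xi> :: (real \<times> (real ^ 'n)) set)"
    using assms unfolding Complex_eq by (intro open_vimage continuous_intros)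
  moreover have "(axial_domain \<Xi> :: (real \<times> (real ^ 'n)) set) = (\<lambda>q. Complex (fst q) (norm (snd q))) -` \<Xi>"
    by (auto simp: axial_domain_def)
  ultimately show ?thesis
    by simp
qed

text \<open>Chain rule through \<open>(x0, r)\<close>. The derivative of \<open>r\<close> in
  direction \<open>v\<close> is \<open>(x \<bullet> v) / r\<close>, and the factor
  \<open>y = r\<close> in the vertical derivative of \<open>radial\<close> cancels the
  denominator.\<close>

lemma has_derivative_radial_axial:
  fixes q :: "real \<times> 'a::real_inner"
  defines "\<zeta> \<equiv> \<lambda>q :: real \<times> 'a. Complex (fst q) (norm (snd q))"
  assumes "open \<Xi>" "h holomorphic_on \<Xi>" "\<zeta> q \<in> \<Xi>" "Im (\<zeta> q) > 0" "s \<le> 1" "bounded_linear L"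
  shows "((\<lambda>q. L (radial s j h (\<zeta> q))) has_derivative (\<lambda>v. fst v * L (radial s j (deriv h) (\<zeta> q)) +
    (snd q \<bullet> snd v) * L (radial s (Suc j) h (\<zeta> q)))) (at q)"
proof -
  interpret L: bounded_linear L by fact
  have nz: "snd q \<noteq> 0"
    using assms(5) by (auto simp: \<zeta>_def)
  have "((\<lambda>q. norm (snd q)) has_derivative (\<lambda>v. snd v \<bullet> sgn (snd q))) (at q)"
    using has_derivative_compose[OF bounded_linear_imp_has_derivative[OF bounded_linear_snd]
        has_derivative_norm[OF nz]] .
  then have "(\<zeta> has_derivative (\<lambda>v. of_real (fst v) + \<i> * of_real (snd v \<bullet> sgn (snd q)))) (at q)"
    unfolding \<zeta>_def Complex_eq by (auto intro!: derivative_eq_intros)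
  then have *: "(\<zeta> has_derivative (\<lambda>v. Complex (fst v) (snd v \<bullet> sgn (snd q)))) (at q)"
    by (simp add: Complex_eq)
  have "has_partials (radial s j h) (radial s j (deriv h) (\<zeta> q))
      (of_real (norm (snd q)) * radial s (Suc j) h (\<zeta> q)) (\<zeta> q)"
    using has_partials_radial[OF assms(2-4) _ assms(6), of j] assms(5) by (simp add: \<zeta>_def)
  from L.has_derivative[OF has_derivative_compose[OF * this[unfolded has_partials_def]]]
  have "((\<lambda>q. L (radial s j h (\<zeta> q))) has_derivative
      (\<lambda>v. L (fst v *\<^sub>R radial s j (deriv h) (\<zeta> q) +
        ((snd v \<bullet> sgn (snd q)) * norm (snd q)) *\<^sub>R radial s (Suc j) h (\<zeta> q)))) (at q)"
    by (simp add: scaleR_conv_of_real mult_ac)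
  moreover have "(v \<bullet> sgn (snd q)) * norm (snd q) = snd q \<bullet> v" for v
    using nz by (simp add: sgn_div_norm inner_commute)
  ultimately show ?thesis
    by (simp add: L.add L.scaleR)
qed

text \<open>The axial Laplacian formula contains the second derivative in \<open>x0\<close> and
  \<open>r^2\<close> times the second radial iterate. The recursion of \<open>radial\<close> trades
  both for \<open>- (2 * (j + s) + 1)\<close> times the next iterate, leaving a single term.\<close>

lemma has_laplacian_on_radial:
  fixes Q :: "real ^ 'n::finite \<Rightarrow> 'b::real_normed_vector"
  defines "\<zeta> \<equiv> \<lambda>q :: real \<times> (real ^ 'n). Complex (fst q) (norm (snd q))"
  assumes "open \<Xi>" "\<Xi> \<subseteq> {z. Im z > 0}" "h holomorphic_on \<Xi>" "s \<le> 1" "bounded_linear L"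
    and Q: "twice_differentiable Q Q1 Q2" "\<And>x. (\<Sum>b\<in>Basis. Q2 b b x) = 0"
      "\<And>t x. Q (t *\<^sub>R x) = t ^ d *\<^sub>R Q x"
  shows "has_laplacian_on (\<lambda>q. L (radial s j h (\<zeta> q)) *\<^sub>R Q (snd q))
    (\<lambda>q. ((real CARD('n) + 2 * real d - 2 * real (j + s) - 1) * L (radial s (Suc j) h (\<zeta> q))) *\<^sub>R
      Q (snd q)) (axial_domain \<Xi>)"
proof -
  interpret L: bounded_linear L by fact
  have \<zeta>: "\<zeta> q \<in> \<Xi>" "Im (\<zeta> q) > 0" if "q \<in> axial_domain \<Xi>" for q
    using that assms(3) by (auto simp: \<zeta>_def axial_domain_def)
  have h': "deriv h holomorphic_on \<Xi>"
    using assms(2,4) by (intro holomorphic_deriv)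
  have deriv: "((\<lambda>q. L (radial s j g (\<zeta> q))) has_derivative (\<lambda>v. fst v * L (radial s j (deriv g) (\<zeta> q)) +
      (snd q \<bullet> snd v) * L (radial s (Suc j) g (\<zeta> q)))) (at q)"
    if "g holomorphic_on \<Xi>" "q \<in> axial_domain \<Xi>" for g j q
    using has_derivative_radial_axial[OF assms(2) that(1) _ _ assms(5,6)] \<zeta>[OF that(2)]
    by (simp add: \<zeta>_def)
  have lap: "has_laplacian_on (\<lambda>q. L (radial s j h (\<zeta> q)) *\<^sub>R Q (snd q))
    (\<lambda>q. (L (radial s j (deriv (deriv h)) (\<zeta> q)) + (norm (snd q))\<^sup>2 * L (radial s (Suc (Suc j)) h (\<zeta> q)) +
      (DIM(real ^ 'n) + 2 * d) * L (radial s (Suc j) h (\<zeta> q))) *\<^sub>R Q (snd q)) (axial_domain \<Xi>)"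
    by (rule has_laplacian_on_axial[OF Q, where ax = "\<lambda>q. L (radial s j (deriv h) (\<zeta> q))"
          and axr = "\<lambda>q. L (radial s (Suc j) (deriv h) (\<zeta> q))"
          and arx = "\<lambda>q. L (radial s (Suc j) (deriv h) (\<zeta> q))"])
      (intro deriv assms(4) h'; assumption)+
  have eq: "L (radial s j (deriv (deriv h)) (\<zeta> q)) +
      (norm (snd q))\<^sup>2 * L (radial s (Suc (Suc j)) h (\<zeta> q)) +
      (DIM(real ^ 'n) + 2 * d) * L (radial s (Suc j) h (\<zeta> q)) =
      (real CARD('n) + 2 * real d - 2 * real (j + s) - 1) * L (radial s (Suc j) h (\<zeta> q))"
    if q: "q \<in> axial_domain \<Xi>" for q
  proof -
    let ?r = "norm (snd q)" and ?R = "\<lambda>j h. radial s j h (\<zeta> q)"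
    have "Im (\<zeta> q) = ?r" "?r \<noteq> 0"
      using \<zeta>(2)[OF q] by (auto simp: \<zeta>_def)
    \<comment> \<open>This is the recursive clause of \<open>radial\<close> with its denominator
      cleared.\<close>
    then have "?r\<^sup>2 *\<^sub>R ?R (Suc (Suc j)) h =
        - ((2 * real (j + s) + 1) *\<^sub>R ?R (Suc j) h + ?R j (deriv (deriv h)))"
      by (simp add: scaleR_conv_of_real)
    from arg_cong[OF this, of L]
    have "?r\<^sup>2 * L (?R (Suc (Suc j)) h) =
        - ((2 * real (j + s) + 1) * L (?R (Suc j) h) + L (?R j (deriv (deriv h))))"
      by (simp only: L.scaleR L.add L.neg real_scaleR_def)
    then show ?thesis
      by (simp add: algebra_simps del: radial.simps)
  qed
  show ?thesis
    using lap by (rule has_laplacian_on_cong) (simp only: eq)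
qed

text \<open>The part with \<open>P\<close> has degree \<open>k\<close> and \<open>s = 0\<close>, the
  part with \<open>x P\<close> has degree \<open>k + 1\<close> and \<open>s = 1\<close>. The two
  changes cancel in the coefficient, so both parts acquire the same factor
  \<open>2 * (n - j)\<close> at every Laplacian.\<close>

lemma fueter_eq:
  fixes P :: "real ^ 'n::{finite,linorder} \<Rightarrow> 'n clifford"
  assumes "odd CARD('n)" "open \<Xi>" "\<Xi> \<subseteq> {z. Im z > 0}" "homogeneous_monogenic_polynomial k P"
    "h holomorphic_on \<Xi>"
  obtains c where "c \<noteq> 0" "\<And>x0 x. Complex x0 (norm x) \<in> \<Xi> \<Longrightarrow> fueter k P h (x0, x) =
    c *\<^sub>R (Re (radial 0 (k + (CARD('n) - 1) div 2) h (Complex x0 (norm x))) *\<^sub>R P x +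
      Im (radial 1 (k + (CARD('n) - 1) div 2) h (Complex x0 (norm x))) *\<^sub>R (clifford_of_vec x \<odot> P x))"
proof -
  define n where "n = k + (CARD('n) - 1) div 2"
  \<comment> \<open>Oddness of the dimension makes the halving exact.\<close>
  have n: "2 * real n = 2 * real k + real CARD('n) - 1"
    using assms(1) by (auto elim!: oddE simp: n_def)
  define \<zeta> where "\<zeta> = (\<lambda>q :: real \<times> (real ^ 'n::{finite,linorder}). Complex (fst q) (norm (snd q)))"
  define G where "G j q = Re (radial 0 j h (\<zeta> q)) *\<^sub>R P (snd q) +
    Im (radial 1 j h (\<zeta> q)) *\<^sub>R (clifford_of_vec (snd q) \<odot> P (snd q))" for j q
  have P: "\<And>t x. P (t *\<^sub>R x) = t ^ k *\<^sub>R P x" "\<And>x. dirac P x = 0"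
    using assms(4) by (auto simp: homogeneous_monogenic_polynomial_def)
  obtain D E where DE: "twice_differentiable P D E"
    using assms(4) polynomial_function_twice_differentiable[of P]
    by (auto simp: homogeneous_monogenic_polynomial_def)
  note lin = linear_cmul[OF linear_clifford_mult(1)] linear_cmul[OF linear_clifford_mult(2)]
    linear_cmul[OF linear_clifford_of_vec]
  have lap_G: "has_laplacian_on (G j) (\<lambda>q. (2 * (real n - real j)) *\<^sub>R G (Suc j) q) (axial_domain \<Xi>)"
    for j
  proof -
    have "has_laplacian_on (\<lambda>q. Re (radial 0 j h (\<zeta> q)) *\<^sub>R P (snd q))
      (\<lambda>q. ((real CARD('n) + 2 * real k - 2 * real (j + 0) - 1) * Re (radial 0 (Suc j) h (\<zeta> q))) *\<^sub>R
        P (snd q)) (axial_domain \<Xi>)"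
      unfolding \<zeta>_def
      by (rule has_laplacian_on_radial[OF assms(2,3,5) _ bounded_linear_Re DE
            monogenic_imp_harmonic[OF DE P(2)] P(1)]) simp
    moreover have "has_laplacian_on
      (\<lambda>q. Im (radial 1 j h (\<zeta> q)) *\<^sub>R (clifford_of_vec (snd q) \<odot> P (snd q)))
      (\<lambda>q. ((real CARD('n) + 2 * real (Suc k) - 2 * real (j + 1) - 1) *
        Im (radial 1 (Suc j) h (\<zeta> q))) *\<^sub>R (clifford_of_vec (snd q) \<odot> P (snd q))) (axial_domain \<Xi>)"
      unfolding \<zeta>_def
      by (rule has_laplacian_on_radial[OF assms(2,3,5) _ bounded_linear_Im
            vec_mult_twice_differentiable[OF DE] monogenic_vec_mult_harmonic[OF DE P(2)]])
        (simp_all add: P(1) lin mult.commute)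
    moreover have "real CARD('n) + 2 * real k - 2 * real (j + 0) - 1 = 2 * (real n - real j)"
      "real CARD('n) + 2 * real (Suc k) - 2 * real (j + 1) - 1 = 2 * (real n - real j)"
      using n by simp_all
    ultimately show ?thesis
      unfolding G_def[abs_def] scaleR_add_right scaleR_scaleR
      by (simp only:) (rule has_laplacian_on_add)
  qed
  have "(laplacian ^^ j) (\<lambda>(x0, x). let r = norm x; w = h (Complex x0 r) in
         (clifford_of_real (Re w) + Im w *\<^sub>R clifford_of_vec (x /\<^sub>R r)) \<odot> P x) q =
      (\<Prod>i<j. 2 * (real n - real i)) *\<^sub>R G j q" if "q \<in> axial_domain \<Xi>" for j q
    using that
  proof (induction j arbitrary: q)
    case 0
    \<comment> \<open>The unit vector \<open>x / r\<close> supplies the division by \<open>r\<close>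
      that \<open>radial 1 0\<close> contains.\<close>
    show ?case
      by (simp add: G_def \<zeta>_def Let_def split_beta lin linear_add[OF linear_clifford_mult(1)]
          clifford_of_real_mult inverse_eq_divide)
  next
    case (Suc j)
    \<comment> \<open>The induction hypothesis holds on the open axial domain, so it may be used
      under the Laplacian.\<close>
    show ?case
      using laplacian_cong[OF open_axial_domain[OF assms(2)] Suc.prems Suc.IH]
        laplacian_eq[OF has_laplacian_on_scaleR[OF lap_G] open_axial_domain[OF assms(2)] Suc.prems]
      by (simp add: mult.commute)
  qed
  then have "fueter k P h q = (\<Prod>i<n. 2 * (real n - real i)) *\<^sub>R G n q" if "q \<in> axial_domain \<Xi>" for q
    using that by (simp add: fueter_def n_def)
  \<comment> \<open>The factors run over \<open>i < n\<close>, so none of them is zero.\<close>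
  moreover have "(\<Prod>i<n. 2 * (real n - real i)) \<noteq> 0"
    by simp
  ultimately show ?thesis
    by (intro that[of "\<Prod>i<n. 2 * (real n - real i)"])
      (auto simp: axial_domain_def G_def \<zeta>_def n_def)
qed

section \<open>Characterisation of the kernel\<close>

lemma homogeneous_nonzero_on_sphere:
  fixes P :: "'a::euclidean_space \<Rightarrow> 'b::real_vector"
  assumes "\<And>t x. P (t *\<^sub>R x) = t ^ k *\<^sub>R P x" "P \<noteq> (\<lambda>x. 0)" "r > 0"
  obtains x where "norm x = r" "P x \<noteq> 0"
proof -
  obtain y where y: "P y \<noteq> 0"
    using assms(2) by auto
  show ?thesis
  proof (cases "y = 0")
    case True
    obtain x :: 'a where x: "norm x = r"
      using vector_choose_size[of r] assms(3) by auto
    \<comment> \<open>With \<open>P 0\<close> nonzero, this forces \<open>P x\<close> to be nonzero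
      at any chosen point of the sphere.\<close>
    have "P y = 0 ^ k *\<^sub>R P x"
      using assms(1)[of 0 x] True by simp
    with y that x show ?thesis
      by auto
  next
    case False
    with y assms(3) show ?thesis
      by (intro that[of "(r / norm y) *\<^sub>R y"]) (auto simp: assms(1))
  qed
qed

text \<open>Over each \<open>z\<close> homogeneity supplies a point \<open>x\<close> with
  \<open>norm x = Im z\<close> and \<open>P x \<noteq> 0\<close>. There \<open>P x\<close> and
  \<open>x P x\<close> are linearly independent over the reals, so both coefficients vanish.\<close>

lemma fueter_kernel_iff_radial:
  fixes P :: "real ^ 'n::{finite,linorder} \<Rightarrow> 'n clifford"
  assumes "odd CARD('n)" "open \<Xi>" "\<Xi> \<subseteq> {z. Im z > 0}" "homogeneous_monogenic_polynomial k P"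
    "P \<noteq> (\<lambda>x. 0)" "h holomorphic_on \<Xi>"
  defines "n \<equiv> k + (CARD('n) - 1) div 2"
  shows "h \<in> fueter_kernel k P \<Xi> \<longleftrightarrow> (\<forall>z\<in>\<Xi>. Re (radial 0 n h z) = 0 \<and> Im (radial 1 n h z) = 0)"
proof -
  obtain c where c: "c \<noteq> 0" "\<And>x0 x. Complex x0 (norm x) \<in> \<Xi> \<Longrightarrow> fueter k P h (x0, x) =
    c *\<^sub>R (Re (radial 0 n h (Complex x0 (norm x))) *\<^sub>R P x +
      Im (radial 1 n h (Complex x0 (norm x))) *\<^sub>R (clifford_of_vec x \<odot> P x))"
    using fueter_eq[OF assms(1-4,6)] unfolding n_def by blast
  show ?thesis
  proof
    assume *: "h \<in> fueter_kernel k P \<Xi>"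
    show "\<forall>z\<in>\<Xi>. Re (radial 0 n h z) = 0 \<and> Im (radial 1 n h z) = 0"
    proof
      fix z assume z: "z \<in> \<Xi>"
      then have "Im z > 0"
        using assms(3) by auto
      then obtain x where x: "norm x = Im z" "P x \<noteq> 0"
        using homogeneous_nonzero_on_sphere[of P k] assms(4,5)
        by (auto simp: homogeneous_monogenic_polynomial_def)
      then have Z: "Complex (Re z) (norm x) = z"
        by simp
      then have "fueter k P h (Re z, x) = 0"
        using * z by (auto simp: fueter_kernel_def axial_domain_def)
      then have "Re (radial 0 n h z) *\<^sub>R P x + Im (radial 1 n h z) *\<^sub>R (clifford_of_vec x \<odot> P x) = 0"
        using c z Z by simp
      moreover have "x \<noteq> 0"
        using x(1) \<open>Im z > 0\<close> by auto
      ultimately show "Re (radial 0 n h z) = 0 \<and> Im (radial 1 n h z) = 0"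
        using clifford_combination_eq_0_iff x(2) by blast
    qed
  next
    assume "\<forall>z\<in>\<Xi>. Re (radial 0 n h z) = 0 \<and> Im (radial 1 n h z) = 0"
    then show "h \<in> fueter_kernel k P \<Xi>"
      using c(2) assms(6) by (auto simp: fueter_kernel_def axial_domain_def)
  qed
qed

text \<open>On a disconnected set the polynomial may differ from component to component, so the
  general kernel is described componentwise; for connected \<open>\<Xi>\<close> this is the space of
  real polynomials. For \<open>P = 0\<close> every holomorphic function would lie in the
  kernel.\<close>

theorem corollary1:
  fixes P :: "real ^ 'n::{finite,linorder} \<Rightarrow> 'n clifford"
    and k :: nat
    and \<Xi> :: "complex set"
  assumes "odd CARD('n)"
    and "open \<Xi>" and "\<Xi> \<subseteq> {z. Im z > 0}"
    and "homogeneous_monogenic_polynomial k P" and "P \<noteq> (\<lambda>x. 0)"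
  shows "(connected \<Xi> \<longrightarrow>
            fueter_kernel k P \<Xi> = real_polynomials_on (2 * int k + int CARD('n) - 2) \<Xi>) \<and>
         fueter_kernel k P \<Xi> =
           {h. \<forall>C\<in>components \<Xi>. h \<in> real_polynomials_on (2 * int k + int CARD('n) - 2) C}"
proof -
  define n where "n = k + (CARD('n) - 1) div 2"
  have n: "2 * int k + int CARD('n) - 2 = 2 * int n - 1"
    using assms(1) by (auto elim!: oddE simp: n_def)
  have C: "open C" "connected C" "C \<subseteq> \<Xi>" if "C \<in> components \<Xi>" for C
    using that assms(2) open_components in_components_connected in_components_subset by blast+
  \<comment> \<open>Components of an open set are open, so holomorphy can be tested on each of
    them.\<close>
  have hol: "h holomorphic_on \<Xi>" if "\<And>C. C \<in> components \<Xi> \<Longrightarrow> h holomorphic_on C" for h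
    using holomorphic_on_UN_open[of "components \<Xi>" h "\<lambda>C. C"] that C(1)
    by (simp add: Union_components[symmetric])
  have poly_hol: "h holomorphic_on C" if "h \<in> real_polynomials_on (2 * int n - 1) C" for h C
  proof -
    obtain q :: "real poly" where "\<forall>z\<in>C. h z = poly (map_poly of_real q) z"
      using \<open>h \<in> _\<close> by (auto simp: real_polynomials_on_def)
    then show ?thesis
      by (subst holomorphic_cong[OF refl]) (auto intro!: holomorphic_intros)
  qed
  have "h \<in> fueter_kernel k P \<Xi> \<longleftrightarrow>
      (\<forall>C\<in>components \<Xi>. h \<in> real_polynomials_on (2 * int n - 1) C)" for h
  proof (cases "h holomorphic_on \<Xi>")
    case True
    have "z \<in> \<Xi> \<longleftrightarrow> (\<exists>C\<in>components \<Xi>. z \<in> C)" for z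
      using Union_components[of \<Xi>] by blast
    then have "h \<in> fueter_kernel k P \<Xi> \<longleftrightarrow>
        (\<forall>C\<in>components \<Xi>. \<forall>z\<in>C. Re (radial 0 n h z) = 0 \<and> Im (radial 1 n h z) = 0)"
      unfolding fueter_kernel_iff_radial[OF assms True, folded n_def]
      by blast
    also have "\<dots> \<longleftrightarrow> (\<forall>C\<in>components \<Xi>. h \<in> real_polynomials_on (2 * int n - 1) C)"
    proof (rule ball_cong[OF refl])
      fix C assume "C \<in> components \<Xi>"
      note C = C[OF this]
      then show "(\<forall>z\<in>C. Re (radial 0 n h z) = 0 \<and> Im (radial 1 n h z) = 0) \<longleftrightarrow>
          h \<in> real_polynomials_on (2 * int n - 1) C"
        using assms(3) holomorphic_on_subset[OF True C(3)]
        by (intro radial_vanishes_iff_real_polynomial) auto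
    qed
    finally show ?thesis .
  next
    \<comment> \<open>A function that is not holomorphic lies in neither set, since componentwise
      polynomials are holomorphic.\<close>
    case False
    then show ?thesis
      using hol[of h] poly_hol[of h] unfolding fueter_kernel_def by blast
  qed
  then have main: "fueter_kernel k P \<Xi> =
      {h. \<forall>C\<in>components \<Xi>. h \<in> real_polynomials_on (2 * int n - 1) C}"
    by blast
  moreover have "{h. \<forall>C\<in>components \<Xi>. h \<in> real_polynomials_on (2 * int n - 1) C} =
      real_polynomials_on (2 * int n - 1) \<Xi>" if "connected \<Xi>"
  proof (cases "\<Xi> = {}")
    \<comment> \<open>The empty set has no components, and every function belongs to both
      sides.\<close>
    case True
    then show ?thesis
      by (auto simp: real_polynomials_on_def)
  next
    case False
    with that have "components \<Xi> = {\<Xi>}"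
      by (simp add: components_eq_sing_iff)
    then show ?thesis
      by simp
  qed
  ultimately show ?thesis
    unfolding n by simp
qed

end
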